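(* Let $x\in\Gamma_1$. For each choice of sign $\pm$, and for fixed $n$, $k_1$, $\Lambda$, $\theta^{\mathrm{inc}}$, $S$, $P$, $H$ and $x$, as the PML thickness $T\to\infty$, the PML oscillatory integral $$\widetilde S_1^{\Gamma_1,\Gamma_2^+}\big[\mathrm{e}^{\pm\mathrm{i}\beta_n\widetilde y_2}\big](x)=\int_{\Gamma_2^+}\widetilde\Phi(k_1,x,y)\,\mathrm{e}^{\pm\mathrm{i}\beta_n\widetilde y_2}\,\mathrm{d}s_y$$ decays as $$\mathcal{O}\!\left(\mathrm{e}^{-(k_1\pm\beta_n)\frac{ST}{P+1}}\right)\quad\text{for } n\in\mathcal{P},$$ and as $$\mathcal{O}\!\left(\mathrm{e}^{-k_1\frac{ST}{P+1}\mp|\beta_n|(H+T)}\right)\quad\text{for } n\in\mathcal{Q}.$$ (Upper signs correspond to the density $\mathrm{e}^{+\mathrm{i}\beta_n\widetilde y_2}$ and lower signs to $\mathrm{e}^{-\mathrm{i}\beta_n\widetilde y_2}$.)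
   Context: Parameters: $k_1>0$ is a wavenumber, $\Lambda>0$ the period, $\theta^{\mathrm{inc}}\in(-\pi/2,\pi/2)$ the incidence angle, $\alpha=k_1\sin\theta^{\mathrm{inc}}$. For $n\in\mathbb{Z}$, $$\alpha_n=\alpha+\frac{2\pi n}{\Lambda},\qquad \beta_n=\begin{cases}\sqrt{k_1^2-\alpha_n^2},&|\alpha_n|\le k_1,\\ \mathrm{i}\sqrt{\alpha_n^2-k_1^2},&|\alpha_n|>k_1,\end{cases}$$ $\mathcal{P}=\{n\in\mathbb{Z}:|\alpha_n|<k_1\}$ (so $\beta_n>0$) and $\mathcal{Q}=\{n\in\mathbb{Z}:|\alpha_n|>k_1\}$ (so $\beta_n\in\mathrm{i}\,(0,\infty)$). Geometry: $\hat f:\mathbb{R}\to\mathbb{R}$ is a smooth function, and $\Gamma_2=\{(\hat f(t),t):t\in\mathbb{R}\}$, $\Gamma_3=\{(\hat f(t)+\Lambda,t):t\in\mathbb{R}\}$, $U=\{(x_1,x_2)\in\mathbb{R}^2:\hat f(x_2)<x_1<\hat f(x_2)+\Lambda\}$ is the unit cell between them. $\Omega_2$ is a bounded obstacle of class $C^2$ with $\overline{\Omega_2}\subset U$, and $\Gamma_1=\partial\Omega_2$. Let $h^+=\sup_{(x_1,x_2)\in\Omega_2}x_2$, $h^-=\inf_{(x_1,x_2)\in\Omega_2}x_2$, and let $H>\max\{h^+,-h^-\}$, $H>0$, be fixed. It is assumed that $\hat f(t)=-\Lambda/2$ for all $|t|>H+T$, so that $$\Gamma_2^+=\Gamma_2\cap\{x_2>H+T\}=\{(-\Lambda/2,y_2):y_2>H+T\}.$$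 Perfectly matched layer (PML): $T>0$ is the PML thickness, $P\ge 2$ is an integer, $S>0$ is the PML scaling parameter, and $$\sigma(t)=\begin{cases}S\left(\frac{t-H}{T}\right)^P,&H\le t\le H+T,\\ S,&t>H+T,\\ 0,&-H\le t\le H,\\ \sigma(-t),&t\le -H.\end{cases}$$ The complex stretched coordinate is $\widetilde x_2=x_2+\mathrm{i}\int_0^{x_2}\sigma(t)\,\mathrm{d}t$ for $x_2\in\mathbb{R}$, and $\widetilde x=(x_1,\widetilde x_2)$, $\widetilde y=(y_1,\widetilde y_2)$. (Note that $\sigma$ depends on $T$.) Kernel: $$\widetilde\Phi(k_1,x,y)=\frac{\mathrm{i}}{4}H_0^{(1)}\big(k_1\rho(\widetilde x,\widetilde y)\big),\qquad \rho(\widetilde x,\widetilde y)=\left[(x_1-y_1)^2+(\widetilde x_2-\widetilde y_2)^2\right]^{1/2},$$ where $z^{1/2}$ is the branch of the square root with nonnegative real part, $\arg(z^{1/2})\in(-\pi/2,\pi/2]$, and $H_0^{(1)}$ is the Hankel function of the first kind of order zero. For a density $\varphi$ on $\Gamma_2^+$, the PML-transformed single-layer operator is $\widetilde S_1^{\Gamma_1,\Gamma_2^+}[\varphi](x)=\int_{\Gamma_2^+}\widetilde\Phi(k_1,x,y)\varphi(y)\,\mathrm{d}s_y$, $x\in\Gamma_1$, understood as an improper integral over the unbounded half-line $\Gamma_2^+$; $\mathrm{d}s_y$ is arc length, i.e. $\mathrm{d}y_2$ on $\Gamma_2^+$.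
   Formalization: For the lower sign the improper integral diverges if α_n=0 (n∈P), or if |β_n|>k_1 S (n∈Q); convergence for large T is asserted exactly outside these two cases, and inside them the bound is only about a conventional value 0. *)

theory Defs
  imports "HOL-Analysis.Analysis" "HOL-Library.Landau_Symbols"
begin

section \<open>Hankel function of the first kind of order zero\<close>

text \<open>
  \<open>H\<^sub>0 = J\<^sub>0 + i Y\<^sub>0\<close>, with \<open>J\<^sub>0\<close> and \<open>Y\<^sub>0\<close> given by their ascending series and the principal
  branch of the logarithm; \<open>harm k\<close> is the \<open>k\<close>-th harmonic number.
\<close>

definition bessel_J0 :: "complex \<Rightarrow> complex" where
  "bessel_J0 z = (\<Sum>k. (- 1) ^ k / (fact k)\<^sup>2 * (z / 2) ^ (2 * k))"

definition bessel_Y0 :: "complex \<Rightarrow> complex" where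
  "bessel_Y0 z =
     2 / of_real pi * (Ln (z / 2) + euler_mascheroni) * bessel_J0 z
     - 2 / of_real pi * (\<Sum>k. (- 1) ^ k * harm k / (fact k)\<^sup>2 * (z / 2) ^ (2 * k))"

definition hankel1_0 :: "complex \<Rightarrow> complex" where
  "hankel1_0 z = bessel_J0 z + \<i> * bessel_Y0 z"

section \<open>Rayleigh modes\<close>

definition alpha :: "real \<Rightarrow> real \<Rightarrow> real \<Rightarrow> int \<Rightarrow> real" where
  "alpha k1 \<Lambda> \<theta> n = k1 * sin \<theta> + 2 * pi * of_int n / \<Lambda>"

definition beta :: "real \<Rightarrow> real \<Rightarrow> real \<Rightarrow> int \<Rightarrow> complex" where
  "beta k1 \<Lambda> \<theta> n =
     (if \<bar>alpha k1 \<Lambda> \<theta> n\<bar> \<le> k1 then of_real (sqrt (k1\<^sup>2 - (alpha k1 \<Lambda> \<theta> n)\<^sup>2))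
      else \<i> * of_real (sqrt ((alpha k1 \<Lambda> \<theta> n)\<^sup>2 - k1\<^sup>2)))"

definition propagating :: "real \<Rightarrow> real \<Rightarrow> real \<Rightarrow> int set" where
  "propagating k1 \<Lambda> \<theta> = {n. \<bar>alpha k1 \<Lambda> \<theta> n\<bar> < k1}"

definition evanescent :: "real \<Rightarrow> real \<Rightarrow> real \<Rightarrow> int set" where
  "evanescent k1 \<Lambda> \<theta> = {n. \<bar>alpha k1 \<Lambda> \<theta> n\<bar> > k1}"

section \<open>Geometry\<close>

definition smooth :: "(real \<Rightarrow> real) \<Rightarrow> bool" where
  "smooth f \<longleftrightarrow> (\<forall>k. (deriv ^^ k) f differentiable_on UNIV)"

definition C2 :: "(real \<Rightarrow> real) \<Rightarrow> bool" where
  "C2 g \<longleftrightarrow> g differentiable_on UNIV \<and> deriv g differentiable_on UNIV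
            \<and> continuous_on UNIV (deriv (deriv g))"

text \<open>
  A nonempty open set lying, near each boundary point, strictly on one side of the graph of a
  \<open>C\<^sup>2\<close> function of one of the two coordinates. The sign \<open>e\<close> selects the side.
\<close>

definition C2_domain :: "(real \<times> real) set \<Rightarrow> bool" where
  "C2_domain \<Omega> \<longleftrightarrow> open \<Omega> \<and> \<Omega> \<noteq> {} \<and>
     (\<forall>p\<in>frontier \<Omega>. \<exists>r>0. \<exists>g. \<exists>e\<in>{1, - 1}. C2 g \<and>
        (\<Omega> \<inter> ball p r = {q \<in> ball p r. e * (snd q - g (fst q)) > 0} \<or>
         \<Omega> \<inter> ball p r = {q \<in> ball p r. e * (fst q - g (snd q)) > 0}))"

definition unit_cell :: "(real \<Rightarrow> real) \<Rightarrow> real \<Rightarrow> (real \<times> real) set" where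
  "unit_cell f \<Lambda> = {(x1, x2). f x2 < x1 \<and> x1 < f x2 + \<Lambda>}"

section \<open>Perfectly matched layer\<close>

definition pml_sigma :: "real \<Rightarrow> real \<Rightarrow> nat \<Rightarrow> real \<Rightarrow> real \<Rightarrow> real" where
  "pml_sigma H S P T t =
     (if \<bar>t\<bar> \<le> H then 0
      else if \<bar>t\<bar> \<le> H + T then S * ((\<bar>t\<bar> - H) / T) ^ P
      else S)"

text \<open>The interval integral is oriented, as needed for negative \<open>x2\<close>.\<close>

definition stretch :: "real \<Rightarrow> real \<Rightarrow> nat \<Rightarrow> real \<Rightarrow> real \<Rightarrow> complex" where
  "stretch H S P T x2 =
     of_real x2 + \<i> * of_real (LBINT t=ereal 0..ereal x2. pml_sigma H S P T t)"

definition pml_rho :: "real \<Rightarrow> real \<Rightarrow> nat \<Rightarrow> real \<Rightarrow> real \<times> real \<Rightarrow> real \<times> real \<Rightarrow> complex" where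
  "pml_rho H S P T x y =
     csqrt ((of_real (fst x - fst y))\<^sup>2
            + (stretch H S P T (snd x) - stretch H S P T (snd y))\<^sup>2)"

definition pml_kernel ::
    "real \<Rightarrow> real \<Rightarrow> nat \<Rightarrow> real \<Rightarrow> real \<Rightarrow> real \<times> real \<Rightarrow> real \<times> real \<Rightarrow> complex" where
  "pml_kernel H S P T k1 x y = \<i> / 4 * hankel1_0 (of_real k1 * pml_rho H S P T x y)"

text \<open>
  The curve \<open>{(f t, t) | t > H + T}\<close> is parametrized by \<open>t\<close>, with arc length element
  \<open>sqrt (1 + (f' t)\<^sup>2) dt\<close>. The Henstock-Kurzweil integral over the unbounded half-line is
  the improper integral, i.e. it need not converge absolutely; \<open>integral\<close> is \<open>0\<close> where it diverges.
\<close>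

definition pml_layer_integrand ::
    "real \<Rightarrow> real \<Rightarrow> nat \<Rightarrow> real \<Rightarrow> real \<Rightarrow> (real \<Rightarrow> real) \<Rightarrow> (real \<times> real \<Rightarrow> complex)
      \<Rightarrow> real \<times> real \<Rightarrow> real \<Rightarrow> complex" where
  "pml_layer_integrand H S P T k1 f \<phi> x t =
     pml_kernel H S P T k1 x (f t, t) * \<phi> (f t, t) * of_real (sqrt (1 + (deriv f t)\<^sup>2))"

definition pml_single_layer_converges ::
    "real \<Rightarrow> real \<Rightarrow> nat \<Rightarrow> real \<Rightarrow> real \<Rightarrow> (real \<Rightarrow> real) \<Rightarrow> (real \<times> real \<Rightarrow> complex)
      \<Rightarrow> real \<times> real \<Rightarrow> bool" where
  "pml_single_layer_converges H S P T k1 f \<phi> x \<longleftrightarrow>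
     pml_layer_integrand H S P T k1 f \<phi> x integrable_on {H + T<..}"

definition pml_single_layer ::
    "real \<Rightarrow> real \<Rightarrow> nat \<Rightarrow> real \<Rightarrow> real \<Rightarrow> (real \<Rightarrow> real) \<Rightarrow> (real \<times> real \<Rightarrow> complex)
      \<Rightarrow> real \<times> real \<Rightarrow> complex" where
  "pml_single_layer H S P T k1 f \<phi> x =
     integral {H + T<..} (pml_layer_integrand H S P T k1 f \<phi> x)"

definition mode_density ::
    "real \<Rightarrow> real \<Rightarrow> nat \<Rightarrow> real \<Rightarrow> real \<Rightarrow> complex \<Rightarrow> real \<times> real \<Rightarrow> complex" where
  "mode_density H S P T s b y = exp (of_real s * \<i> * b * stretch H S P T (snd y))"

end

theory Submission
  imports Defs "HOL-Real_Asymp.Real_Asymp"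
begin

text \<open>
  Put \<open>t = H + T + \<tau>\<close> on the half-line. The stretched vertical distance from \<open>x\<close> is
  \<open>Z = Z0 + (1 + \<i> S) \<tau>\<close> with \<open>Im Z0 = S T / (P + 1)\<close>, and the complex distance \<open>\<rho>\<close> differs from \<open>Z\<close> by
  \<open>O(1 / \<bar>Z\<bar>)\<close>. Since \<open>H\<^sub>0(z) = exp (\<i> z) h(z)\<close> with a slowly varying amplitude \<open>h\<close> of size
  \<open>1 / sqrt \<bar>z\<bar>\<close>, the integrand equals \<open>K exp (c \<tau>) g(\<tau>)\<close>. The constant \<open>K\<close> has, up to a factor \<open>4\<close>,
  the modulus of the claimed bound, the rate \<open>c = \<i> (k\<^sub>1 + s \<beta>) (1 + \<i> S)\<close> does not depend on
  \<open>T\<close>, and \<open>\<bar>g\<bar> \<le> C / sqrt (1 + \<tau>)\<close>, \<open>\<bar>g'\<bar> \<le> C / sqrt (1 + \<tau>) ^ 3\<close> with \<open>C\<close> independent of \<open>T\<close>.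

  If \<open>Re c \<le> 0\<close> and \<open>c \<noteq> 0\<close>, integration by parts shows that the integral of \<open>exp (c \<tau>) g(\<tau>)\<close>
  converges and is at most \<open>3 C / \<bar>c\<bar>\<close> (\<open>oscillatory_integral_converges\<close>). For lower signs also
  \<open>c = 0\<close> (normal propagation) and \<open>Re c > 0\<close> (strongly growing evanescent modes) occur. Then a lower
  bound for \<open>\<bar>g\<bar>\<close> shows that the integral diverges (\<open>oscillatory_integral_diverges\<close>) and its
  value is \<open>0\<close> by convention.

  The bounds for \<open>h\<close> and \<open>h'\<close> in the first quadrant (\<open>hankel_amplitude_bounds\<close>) come from
  Bessel's equation alone, once it is known that \<open>H\<^sub>0\<close> is its recessive solution on the imaginary axis.
  There \<open>H\<^sub>0(\<i> y)\<close> is a multiple of \<open>K\<^sub>0(y)\<close>, and the power series express \<open>K\<^sub>0 / I\<^sub>0\<close> as the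
  mean of \<open>harm k - euler_mascheroni - ln (y / 2)\<close> with respect to the weights of
  \<open>I\<^sub>0\<close>; second moments, which are known exactly, show that \<open>\<bar>K\<^sub>0\<bar> \<le> (2 / y) I\<^sub>0\<close>. This rules out the growing
  solution and pins down the size of \<open>K\<^sub>0\<close> (\<open>scaled_K0_bounds\<close>), and the equation transports the
  bounds from the axis to the quadrant along horizontal lines (\<open>horizontal_line_bounds\<close>).
\<close>

section \<open>Bessel's equation\<close>

text \<open>
  \<open>f'' + f' / z + f = 0\<close> on the upper half-plane, with \<open>f'\<close> carried along as a function, so that no
  second derivative has to be named. The half-plane avoids the cut of the logarithm and contains
  every value \<open>k\<^sub>1 \<rho>\<close> at which the Hankel function will be needed.
\<close>

definition bessel_eq :: "(complex \<Rightarrow> complex) \<Rightarrow> (complex \<Rightarrow> complex) \<Rightarrow> bool" where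
  "bessel_eq f f' \<longleftrightarrow> (\<forall>z. Im z > 0 \<longrightarrow>
     (f has_field_derivative f' z) (at z) \<and>
     (f' has_field_derivative - f z - f' z / z) (at z))"

text \<open>
  In the variable \<open>\<xi> = z\<^sup>2 / 4\<close> Bessel's operator is \<open>\<xi> \<partial>\<^sup>2 + \<partial>\<close>, which acts on power series by
  \<open>c\<^sub>n \<mapsto> (n + 1)\<^sup>2 c\<^sub>n\<^sub>+\<^sub>1\<close>.
\<close>

lemma power_series_bessel_operator:
  fixes c :: "nat \<Rightarrow> complex"
  assumes "\<And>\<xi>. summable (\<lambda>n. c n * \<xi> ^ n)"
  shows "(\<lambda>n. (of_nat (Suc n))\<^sup>2 * c (Suc n) * \<xi> ^ n) sums
           (\<xi> * (\<Sum>n. diffs (diffs c) n * \<xi> ^ n) + (\<Sum>n. diffs c n * \<xi> ^ n))"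
proof -
  have s1: "summable (\<lambda>n. diffs c n * \<xi> ^ n)" for \<xi>
    using assms by (rule termdiff_converges_all)
  have s2: "summable (\<lambda>n. diffs (diffs c) n * \<xi> ^ n)"
    using s1 by (rule termdiff_converges_all)
  have "(\<lambda>n. \<xi> * (diffs (diffs c) n * \<xi> ^ n)) sums (\<xi> * (\<Sum>n. diffs (diffs c) n * \<xi> ^ n))"
    using s2 by (intro sums_mult summable_sums)
  then have "(\<lambda>n. (\<lambda>n. of_nat n * diffs c n * \<xi> ^ n) (Suc n)) sums
     (\<xi> * (\<Sum>n. diffs (diffs c) n * \<xi> ^ n))"
    by (simp add: diffs_def algebra_simps)
  then have "(\<lambda>n. of_nat n * diffs c n * \<xi> ^ n) sums (\<xi> * (\<Sum>n. diffs (diffs c) n * \<xi> ^ n) + 0)"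
    by (subst (asm) sums_Suc_iff) simp
  from sums_add[OF this summable_sums[OF s1[of \<xi>]]]
  show ?thesis
    by (simp add: diffs_def algebra_simps power2_eq_square)
qed

text \<open>
  The coefficients of the two series of \<open>J\<^sub>0\<close> and \<open>Y\<^sub>0\<close> in powers of \<open>z\<^sup>2 / 4\<close>.
\<close>

definition jcoeff :: "nat \<Rightarrow> complex" where "jcoeff k = (- 1) ^ k / (fact k)\<^sup>2"
definition ycoeff :: "nat \<Rightarrow> complex" where "ycoeff k = (- 1) ^ k * harm k / (fact k)\<^sup>2"

lemma harm_le_of_nat: "harm k \<le> (of_nat k :: real)"
proof (induction k)
  case (Suc k)
  have "inverse (real (Suc k)) \<le> 1" by (simp add: field_simps)
  then show ?case using Suc by (simp add: harm_Suc)
qed (simp add: harm_def)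

lemma jcoeff_Suc: "(of_nat (Suc n))\<^sup>2 * jcoeff (Suc n) = - jcoeff n"
  by (simp add: jcoeff_def field_simps power2_eq_square del: of_nat_Suc)

text \<open>
  The second series solves an inhomogeneous equation. Its right-hand side, the derivative of the
  first series, cancels what differentiating the factor \<open>Ln\<close> produces.
\<close>

lemma ycoeff_Suc:
  "(of_nat (Suc n))\<^sup>2 * ycoeff (Suc n) = - ycoeff n + diffs jcoeff n"
proof -
  have "ycoeff k = jcoeff k * harm k" for k by (simp add: jcoeff_def ycoeff_def)
  then have "(of_nat (Suc n))\<^sup>2 * ycoeff (Suc n)
      = ((of_nat (Suc n))\<^sup>2 * jcoeff (Suc n)) * (harm n + inverse (of_nat (Suc n)))"
    by (simp add: harm_Suc)
  also have "\<dots> = - ycoeff n + (of_nat (Suc n))\<^sup>2 * jcoeff (Suc n) * inverse (of_nat (Suc n))"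
    unfolding distrib_left jcoeff_Suc using \<open>\<And>k. ycoeff k = jcoeff k * harm k\<close> by simp
  also have "(of_nat (Suc n))\<^sup>2 * jcoeff (Suc n) * inverse (of_nat (Suc n)) = diffs jcoeff n"
    by (simp add: diffs_def power2_eq_square del: of_nat_Suc)
  finally show ?thesis .
qed

lemma norm_ycoeff_le: "norm (ycoeff k) \<le> 1 / fact k"
proof -
  have "harm k \<le> (fact k :: real)"
    using harm_le_of_nat[of k] fact_ge_self[of k]
    by (metis (mono_tags, lifting) of_nat_fact of_nat_mono order_trans)
  have "norm (harm k :: complex) = harm k"
    by (metis harm_nonneg norm_of_real abs_of_nonneg of_real_harm)
  then have "norm (ycoeff k) = harm k / (fact k)\<^sup>2"
    by (simp add: ycoeff_def norm_mult norm_divide norm_power)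
  also have "\<dots> \<le> fact k / (fact k)\<^sup>2"
    by (intro divide_right_mono \<open>harm k \<le> fact k\<close>) auto
  finally show ?thesis by (simp add: power2_eq_square)
qed

lemma norm_jcoeff_le: "norm (jcoeff k) \<le> 1 / fact k"
proof -
  have "norm (jcoeff k) = 1 / (fact k)\<^sup>2"
    by (simp add: jcoeff_def norm_mult norm_divide norm_power)
  also have "\<dots> \<le> 1 / fact k"
    by (intro divide_left_mono) (auto simp: power2_eq_square fact_ge_1)
  finally show ?thesis .
qed

lemma summable_if_le_inverse_fact:
  fixes c :: "nat \<Rightarrow> complex"
  assumes "\<And>k. norm (c k) \<le> 1 / fact k"
  shows "summable (\<lambda>n. c n * \<xi> ^ n)"
proof (rule summable_comparison_test)
  show "summable (\<lambda>n. norm \<xi> ^ n / fact n)"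
    using summable_exp[of "norm \<xi>"] by (simp add: field_simps)
  show "\<exists>N. \<forall>n\<ge>N. norm (c n * \<xi> ^ n) \<le> norm \<xi> ^ n / fact n"
    using mult_right_mono[OF assms] by (fastforce simp: norm_mult norm_power)
qed

lemmas summable_jcoeff = summable_if_le_inverse_fact[OF norm_jcoeff_le]
lemmas summable_ycoeff = summable_if_le_inverse_fact[OF norm_ycoeff_le]

lemma bessel_J0_hankel1_0_solve_bessel_eq:
  obtains J' H' where "bessel_eq bessel_J0 J'" "bessel_eq hankel1_0 H'"
proof -
  define ser :: "(nat \<Rightarrow> complex) \<Rightarrow> complex \<Rightarrow> complex"
    where "ser c \<xi> = (\<Sum>n. c n * \<xi> ^ n)" for c \<xi>
  define F where "F = ser jcoeff"
  define F1 where "F1 = ser (diffs jcoeff)"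
  define F2 where "F2 = ser (diffs (diffs jcoeff))"
  define G where "G = ser ycoeff"
  define G1 where "G1 = ser (diffs ycoeff)"
  define G2 where "G2 = ser (diffs (diffs ycoeff))"
  have der: "(ser c has_field_derivative ser (diffs c) \<xi>) (at \<xi>)"
    if "\<And>\<xi>. summable (\<lambda>n. c n * \<xi> ^ n)" for c \<xi>
    unfolding ser_def using termdiffs_strong_converges_everywhere[OF that] by blast
  note dd = summable_jcoeff summable_ycoeff termdiff_converges_all
  have dF: "(F has_field_derivative F1 \<xi>) (at \<xi>)" "(F1 has_field_derivative F2 \<xi>) (at \<xi>)"
    and dG: "(G has_field_derivative G1 \<xi>) (at \<xi>)" "(G1 has_field_derivative G2 \<xi>) (at \<xi>)" for \<xi>
    unfolding F_def F1_def F2_def G_def G1_def G2_def by (intro der dd; fail)+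
  have chain: "((\<lambda>z. f (z\<^sup>2 / 4)) has_field_derivative f' (z\<^sup>2 / 4) * (z / 2)) (at z)"
    if "\<And>\<xi>. (f has_field_derivative f' \<xi>) (at \<xi>)" for f f' :: "complex \<Rightarrow> complex" and z
    by (rule DERIV_chain2[OF that]) (auto intro!: derivative_eq_intros)
  note chain = chain[OF dF(1)] chain[OF dF(2)] chain[OF dG(1)] chain[OF dG(2)]
  have "(\<lambda>n. - (jcoeff n * \<xi> ^ n)) sums (\<xi> * F2 \<xi> + F1 \<xi>)" for \<xi>
    using power_series_bessel_operator[OF summable_jcoeff, of \<xi>]
    by (simp only: jcoeff_Suc F1_def F2_def ser_def mult_minus_left)
  moreover have "(\<lambda>n. - (jcoeff n * \<xi> ^ n)) sums (- F \<xi>)" for \<xi>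
    unfolding F_def ser_def by (intro sums_minus summable_sums summable_jcoeff)
  ultimately have F_eq: "\<xi> * F2 \<xi> + F1 \<xi> = - F \<xi>" for \<xi>
    using sums_unique2 by blast
  have "(\<lambda>n. - (ycoeff n * \<xi> ^ n) + diffs jcoeff n * \<xi> ^ n) sums (\<xi> * G2 \<xi> + G1 \<xi>)" for \<xi>
    using power_series_bessel_operator[OF summable_ycoeff, of \<xi>]
    by (simp only: ycoeff_Suc G1_def G2_def ser_def mult_minus_left distrib_right)
  moreover have "(\<lambda>n. - (ycoeff n * \<xi> ^ n) + diffs jcoeff n * \<xi> ^ n) sums (- G \<xi> + F1 \<xi>)" for \<xi>
    unfolding G_def F1_def ser_def by (intro sums_add sums_minus summable_sums dd)
  ultimately have G_eq: "\<xi> * G2 \<xi> + G1 \<xi> = - G \<xi> + F1 \<xi>" for \<xi>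
    using sums_unique2 by blast
  have pw: "(z / 2) ^ (2 * k) = (z\<^sup>2 / 4) ^ k" for z :: complex and k
    by (simp add: power_mult power_divide)
  have J: "bessel_J0 z = F (z\<^sup>2 / 4)" for z
    by (simp only: bessel_J0_def F_def ser_def jcoeff_def pw)
  \<comment> \<open>The Hankel function is \<open>L F - p G\<close> with the logarithmic factor \<open>L\<close>; in the equation, terms with \<open>L\<close> cancel by that of \<open>F\<close>, the others by that of \<open>G\<close>.\<close>
  define p where "p = 2 * \<i> / of_real pi"
  define L where "L z = 1 + p * (Ln (z / 2) + euler_mascheroni)" for z
  have H: "hankel1_0 z = L z * F (z\<^sup>2 / 4) - p * G (z\<^sup>2 / 4)" for z
    unfolding hankel1_0_def bessel_Y0_def J L_def p_def pw G_def ser_def ycoeff_def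
    by (simp add: algebra_simps add_divide_distrib)
  define J' where "J' z = F1 (z\<^sup>2 / 4) * (z / 2)" for z
  define H' where "H' z = L z * F1 (z\<^sup>2 / 4) * (z / 2) + p / z * F (z\<^sup>2 / 4)
      - p * G1 (z\<^sup>2 / 4) * (z / 2)" for z
  have dL: "(L has_field_derivative p / z) (at z)" if "Im z > 0" for z
  proof -
    have "z / 2 \<notin> \<real>\<^sub>\<le>\<^sub>0" using that by (auto simp: complex_nonpos_Reals_iff)
    then show ?thesis unfolding L_def
      by (auto intro!: derivative_eq_intros simp: field_simps)
  qed
  have "bessel_eq bessel_J0 J'"
    unfolding bessel_eq_def
  proof (intro allI impI conjI)
    fix z :: complex assume "Im z > 0"
    then have "z \<noteq> 0" by auto
    show "(bessel_J0 has_field_derivative J' z) (at z)"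
      unfolding J[abs_def] J'_def by (rule chain)
    have "(J' has_field_derivative z\<^sup>2 / 4 * F2 (z\<^sup>2 / 4) + F1 (z\<^sup>2 / 4) / 2) (at z)"
      unfolding J'_def[abs_def]
      by (rule DERIV_cong, (rule derivative_intros chain)+) (simp_all add: algebra_simps power2_eq_square)
    also have "z\<^sup>2 / 4 * F2 (z\<^sup>2 / 4) + F1 (z\<^sup>2 / 4) / 2 = - bessel_J0 z - J' z / z"
      using F_eq[of "z\<^sup>2 / 4"] \<open>z \<noteq> 0\<close> by (simp add: J J'_def algebra_simps)
    finally show "(J' has_field_derivative - bessel_J0 z - J' z / z) (at z)" .
  qed
  moreover have "bessel_eq hankel1_0 H'"
    unfolding bessel_eq_def
  proof (intro allI impI conjI)
    fix z :: complex assume z: "Im z > 0"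
    then have "z \<noteq> 0" by auto
    show "(hankel1_0 has_field_derivative H' z) (at z)"
      unfolding H[abs_def]
      by (rule DERIV_cong, (rule derivative_intros chain dL z)+)
         (simp add: H'_def algebra_simps)
    have dp: "((\<lambda>z. p / z) has_field_derivative - p / z\<^sup>2) (at z)"
      using \<open>z \<noteq> 0\<close> by (auto intro!: derivative_eq_intros simp: power2_eq_square)
    have half: "((\<lambda>z. z / 2) has_field_derivative 1 / 2) (at z)"
      by (auto intro!: derivative_eq_intros)
    define \<xi> where "\<xi> = z\<^sup>2 / 4"
    have "(H' has_field_derivative L z * (\<xi> * F2 \<xi> + F1 \<xi> / 2) + p * F1 \<xi> - p * F \<xi> / z\<^sup>2
        - p * (\<xi> * G2 \<xi> + G1 \<xi> / 2)) (at z)"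
      unfolding H'_def[abs_def] \<xi>_def
      by (rule DERIV_cong[OF DERIV_diff[OF DERIV_add[OF DERIV_mult[OF DERIV_mult[OF dL[OF z] chain(2)] half]
              DERIV_mult[OF dp chain(1)]] DERIV_mult[OF DERIV_cmult[OF chain(4)] half]]])
         (use \<open>z \<noteq> 0\<close> in \<open>simp add: field_simps power2_eq_square\<close>)
    also have "L z * (\<xi> * F2 \<xi> + F1 \<xi> / 2) + p * F1 \<xi> - p * F \<xi> / z\<^sup>2 - p * (\<xi> * G2 \<xi> + G1 \<xi> / 2)
        = L z * (\<xi> * F2 \<xi> + F1 \<xi>) - L z * F1 \<xi> / 2 + p * F1 \<xi> - p * F \<xi> / z\<^sup>2
          - p * (\<xi> * G2 \<xi> + G1 \<xi>) + p * G1 \<xi> / 2"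
      by (simp add: algebra_simps)
    also have "\<dots> = - hankel1_0 z - H' z / z"
      unfolding F_eq G_eq H H'_def \<xi>_def[symmetric]
      using \<open>z \<noteq> 0\<close> by (simp add: field_simps power2_eq_square)
    finally show "(H' has_field_derivative - hankel1_0 z - H' z / z) (at z)" .
  qed
  ultimately show ?thesis using that by blast
qed

text \<open>
  On the imaginary axis Bessel's equation becomes the modified equation \<open>K'' = K - K' / y\<close>. The factor
  \<open>a\<close> serves to rotate the Hankel function, which is purely imaginary there, to real values.
\<close>

lemma bessel_eq_imaginary_axis:
  assumes "bessel_eq f f'" "y > 0"
  shows "((\<lambda>y. Re (a * f (\<i> * of_real y))) has_real_derivative
            Re (a * \<i> * f' (\<i> * of_real y))) (at y)"
    and "((\<lambda>y. Re (a * \<i> * f' (\<i> * of_real y))) has_real_derivative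
            Re (a * f (\<i> * of_real y)) - Re (a * \<i> * f' (\<i> * of_real y)) / y) (at y)"
proof -
  have im: "Im (\<i> * of_real y) > 0" using assms by simp
  have d: "((\<lambda>y. \<i> * of_real y) has_vector_derivative \<i>) (at y)"
    by (auto intro!: derivative_eq_intros)
  have f: "((\<lambda>y. f (\<i> * of_real y)) has_vector_derivative \<i> * f' (\<i> * of_real y)) (at y)"
    using field_vector_diff_chain_at[OF d] im assms(1) unfolding bessel_eq_def o_def by blast
  have f': "((\<lambda>y. f' (\<i> * of_real y)) has_vector_derivative
      \<i> * (- f (\<i> * of_real y) - f' (\<i> * of_real y) / (\<i> * of_real y))) (at y)"
    using field_vector_diff_chain_at[OF d] im assms(1) unfolding bessel_eq_def o_def by blast
  have re: "((\<lambda>y. Re (g y)) has_real_derivative Re g') (at y)"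
    if "(g has_vector_derivative g') (at y)" for g g'
    using bounded_linear.has_vector_derivative[OF bounded_linear_Re that]
    by (simp add: has_real_derivative_iff_has_vector_derivative)
  show "((\<lambda>y. Re (a * f (\<i> * of_real y))) has_real_derivative
            Re (a * \<i> * f' (\<i> * of_real y))) (at y)"
    using re[OF has_vector_derivative_mult_right[OF f, of a]] by (simp add: mult.assoc)
  have "Re (a * \<i> * (\<i> * (- f (\<i> * of_real y) - f' (\<i> * of_real y) / (\<i> * of_real y))))
     = Re (a * f (\<i> * of_real y)) - Re (a * \<i> * f' (\<i> * of_real y)) / y"
    using assms by (simp add: Re_divide Im_divide power2_eq_square field_simps)
  then show "((\<lambda>y. Re (a * \<i> * f' (\<i> * of_real y))) has_real_derivative
            Re (a * f (\<i> * of_real y)) - Re (a * \<i> * f' (\<i> * of_real y)) / y) (at y)"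
    using re[OF has_vector_derivative_mult_right[OF f', of "a * \<i>"]] by metis
qed

section \<open>The Macdonald function on the positive axis\<close>

text \<open>
  Divided by their sum \<open>I\<^sub>0(y)\<close> these weights form a probability distribution on the naturals,
  concentrated near \<open>k = y / 2\<close>. Since \<open>harm k\<close> is about \<open>euler_mascheroni + ln k\<close>, the quotient
  \<open>K\<^sub>0 / I\<^sub>0\<close>, the expectation of \<open>harm k - euler_mascheroni - ln (y / 2)\<close>, must be small for large \<open>y\<close>.
\<close>

definition bessel_weight :: "real \<Rightarrow> nat \<Rightarrow> real" where
  "bessel_weight y k = (y / 2) ^ (2 * k) / (fact k)\<^sup>2"

definition modified_I0 :: "real \<Rightarrow> real" where
  "modified_I0 y = (\<Sum>k. bessel_weight y k)"

text \<open>
  The Macdonald function \<open>K\<^sub>0\<close>, with its logarithmic term \<open>- (ln (y / 2) + euler_mascheroni) I\<^sub>0(y)\<close>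
  distributed over the series of \<open>I\<^sub>0\<close>.
\<close>

definition modified_K0 :: "real \<Rightarrow> real" where
  "modified_K0 y = (\<Sum>k. bessel_weight y k * (harm k - euler_mascheroni - ln (y / 2)))"

lemma bessel_weight_nonneg: "bessel_weight y k \<ge> 0"
  by (simp add: bessel_weight_def)

lemma bessel_weight_Suc:
  "(real (Suc k))\<^sup>2 * bessel_weight y (Suc k) = (y / 2)\<^sup>2 * bessel_weight y k"
  by (simp add: bessel_weight_def power2_eq_square field_simps del: of_nat_Suc)

lemma bessel_weight_jcoeff:
  "jcoeff k * ((\<i> * of_real y) / 2) ^ (2 * k) = of_real (bessel_weight y k)"
proof -
  have "((\<i> * of_real y) / 2) ^ (2 * k) = (- 1 :: complex) ^ k * of_real ((y / 2) ^ (2 * k))"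
  proof -
    have "((\<i> * of_real y) / 2)\<^sup>2 = (- 1 :: complex) * of_real ((y / 2)\<^sup>2)"
      by (simp add: power2_eq_square field_simps)
    then show ?thesis by (simp only: power_mult power_mult_distrib of_real_power)
  qed
  then show ?thesis
    by (simp add: jcoeff_def bessel_weight_def)
qed

lemma bessel_weight_ycoeff:
  "ycoeff k * ((\<i> * of_real y) / 2) ^ (2 * k) = of_real (bessel_weight y k * harm k)"
proof -
  have "ycoeff k = jcoeff k * harm k" by (simp add: jcoeff_def ycoeff_def)
  then show ?thesis using bessel_weight_jcoeff[of k y] by (simp add: of_real_harm mult_ac)
qed

lemma summable_bessel_weight: "summable (bessel_weight y)"
  and summable_bessel_weight_harm: "summable (\<lambda>k. bessel_weight y k * harm k)"
proof -
  have "summable (\<lambda>k. complex_of_real (bessel_weight y k))"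
    unfolding bessel_weight_jcoeff[symmetric] power_mult by (rule summable_jcoeff)
  then show "summable (bessel_weight y)" by (simp only: summable_complex_of_real)
  have "summable (\<lambda>k. complex_of_real (bessel_weight y k * harm k))"
    unfolding bessel_weight_ycoeff[symmetric] power_mult by (rule summable_ycoeff)
  then show "summable (\<lambda>k. bessel_weight y k * harm k)"
    by (simp only: summable_complex_of_real)
qed

lemma modified_I0_sums: "bessel_weight y sums modified_I0 y"
  unfolding modified_I0_def by (rule summable_sums[OF summable_bessel_weight])

lemma modified_K0_sums:
  "(\<lambda>k. bessel_weight y k * (harm k - euler_mascheroni - ln (y / 2))) sums modified_K0 y"
proof -
  have "summable (\<lambda>k. bessel_weight y k * harm k
      - (euler_mascheroni + ln (y / 2)) * bessel_weight y k)"
    by (intro summable_diff summable_mult summable_bessel_weight summable_bessel_weight_harm)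
  then show ?thesis unfolding modified_K0_def
    by (intro summable_sums) (simp add: algebra_simps)
qed

lemma modified_K0_sums':
  "(\<lambda>k. bessel_weight y k * harm k) sums
     (modified_K0 y + (euler_mascheroni + ln (y / 2)) * modified_I0 y)"
  using sums_add[OF modified_K0_sums[of y]
      sums_mult[OF modified_I0_sums[of y], of "euler_mascheroni + ln (y / 2)"]]
  by (simp add: algebra_simps)

lemma bessel_J0_imaginary: "bessel_J0 (\<i> * of_real y) = of_real (modified_I0 y)"
  unfolding bessel_J0_def jcoeff_def[symmetric] bessel_weight_jcoeff modified_I0_def
  by (rule suminf_of_real[OF summable_bessel_weight, symmetric])

lemma hankel1_0_imaginary:
  assumes "y > 0"
  shows "hankel1_0 (\<i> * of_real y) = - (2 * \<i> / of_real pi) * of_real (modified_K0 y)"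
proof -
  have "Ln (\<i> * of_real y / 2) = Ln (of_real (y / 2) * \<i>)" by (simp add: mult.commute)
  also have "\<dots> = of_real (ln (y / 2)) + Ln \<i>"
    using Ln_times_of_real[of "y / 2" \<i>] Ln_of_real[of "y / 2"] assms by simp
  finally have L: "Ln (\<i> * of_real y / 2) = of_real (ln (y / 2)) + \<i> * of_real pi / 2"
    by (simp only: Ln_ii)
  have S: "(\<Sum>k. (- 1) ^ k * harm k / (fact k)\<^sup>2 * (\<i> * of_real y / 2) ^ (2 * k))
     = complex_of_real (modified_K0 y + (euler_mascheroni + ln (y / 2)) * modified_I0 y)"
    unfolding ycoeff_def[symmetric] bessel_weight_ycoeff
    using sums_unique[OF sums_of_real[OF modified_K0_sums'[of y]]]
    by metis
  have e: "(euler_mascheroni :: complex) = of_real euler_mascheroni" by simp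
  show ?thesis
    unfolding hankel1_0_def bessel_Y0_def S L bessel_J0_imaginary e
    by (simp add: field_simps del: of_real_euler_mascheroni)
qed

lemma sums_zero_extend:
  fixes f :: "nat \<Rightarrow> real"
  assumes "(\<lambda>k. f (Suc k)) sums s" "f 0 = 0"
  shows "f sums s"
  using assms sums_Suc_iff[of f s] by simp

text \<open>
  The recursion of the weights gives the second moment exactly, and likewise the second inverse
  moment below. They replace an explicit concentration estimate.
\<close>

lemma modified_I0_second_moment:
  "(\<lambda>k. (real k)\<^sup>2 * bessel_weight y k) sums ((y / 2)\<^sup>2 * modified_I0 y)"
  by (rule sums_zero_extend, subst bessel_weight_Suc)
     (auto intro: sums_mult modified_I0_sums)

lemma modified_I0_inverse_second_moment:
  assumes "y > 0"
  shows "(\<lambda>k. (y / 2 / real (Suc k))\<^sup>2 * bessel_weight y k) sums (modified_I0 y - 1)"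
proof -
  have "(y / 2 / real (Suc k))\<^sup>2 * bessel_weight y k = bessel_weight y (Suc k)" for k
    using bessel_weight_Suc[of k y] by (simp add: field_simps power2_eq_square del: of_nat_Suc)
  then show ?thesis
    using modified_I0_sums[of y] sums_Suc_iff[of "bessel_weight y" "modified_I0 y - 1"]
    by (simp add: bessel_weight_def[of y 0])
qed

lemma modified_I0_ge_1: "modified_I0 y \<ge> 1"
proof -
  have "bessel_weight y 0 = 1" by (simp add: bessel_weight_def)
  then show ?thesis
    using sum_le_suminf[OF summable_bessel_weight, of "{0}" y] bessel_weight_nonneg
    by (simp add: modified_I0_def)
qed

text \<open>
  Comparison with \<open>cosh\<close>, as \<open>(2k)! \<le> 4\<^sup>k (k!)\<^sup>2\<close> by the trivial bound for the central binomial
  coefficient.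
\<close>

lemma modified_I0_le_exp:
  assumes "y \<ge> 0"
  shows "modified_I0 y \<le> exp y"
proof -
  have "bessel_weight y k \<le> y ^ (2 * k) / fact (2 * k)" for k
  proof -
    have "(fact (2 * k) :: real) \<le> 2 ^ (2 * k) * (fact k)\<^sup>2"
    proof -
      have "real (2 * k choose k) \<le> 2 ^ (2 * k)"
        by (metis binomial_le_pow2 of_nat_le_iff of_nat_numeral of_nat_power)
      moreover have "real (2 * k choose k) * (fact k)\<^sup>2 = fact (2 * k)"
        using binomial_fact[of k "2 * k", where 'a = real] by (simp add: power2_eq_square)
      ultimately show ?thesis
        by (metis mult_right_mono zero_le_power2)
    qed
    then have "y ^ (2 * k) / (2 ^ (2 * k) * (fact k)\<^sup>2) \<le> y ^ (2 * k) / fact (2 * k)"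
      using assms by (intro divide_left_mono) auto
    then show ?thesis by (simp add: bessel_weight_def power_divide)
  qed
  moreover have "(\<lambda>k. y ^ (2 * k) / fact (2 * k)) sums cosh y"
  proof -
    define g where "g n = (if even n then y ^ n /\<^sub>R fact n else 0)" for n
    have "(\<lambda>k. g (2 * k)) sums cosh y"
      using cosh_converges[of y] unfolding g_def[abs_def, symmetric]
      by (subst sums_mono_reindex) (auto simp: strict_mono_def g_def elim!: evenE)
    then show ?thesis by (simp add: g_def divide_inverse mult.commute)
  qed
  ultimately have "modified_I0 y \<le> cosh y"
    by (intro sums_le[OF _ modified_I0_sums]) auto
  also have "\<dots> \<le> exp y" using assms by (simp add: cosh_def)
  finally show ?thesis .
qed

lemma harm_euler_mascheroni_bounds:
  "harm k - euler_mascheroni \<le> ln (real (Suc k))"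
  "harm k - euler_mascheroni \<ge> ln (real (Suc k)) - 1 / real (Suc k)"
proof -
  show "harm k - euler_mascheroni \<le> ln (real (Suc k))"
  proof (cases k)
    case 0
    then show ?thesis using euler_mascheroni_pos by (simp add: harm_def)
  next
    case (Suc n)
    have "0 \<le> 1 / real (2 * (n + 2))" by simp
    then have "harm (Suc n) - ln (real (n + 2)) \<le> euler_mascheroni"
      using euler_mascheroni_lower[of n] by linarith
    then show ?thesis using Suc by (simp add: add.commute)
  qed
  show "harm k - euler_mascheroni \<ge> ln (real (Suc k)) - 1 / real (Suc k)"
  proof (cases k)
    case 0
    then show ?thesis using euler_mascheroni_less_13_over_22 by (simp add: harm_def)
  next
    case (Suc n)
    have "1 / real (2 * (n + 1)) \<le> 1 / real (Suc k)" using Suc by (intro divide_left_mono) auto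
    then show ?thesis using euler_mascheroni_upper[of n] Suc by (simp add: add.commute)
  qed
qed

text \<open>
  Bounds of the expectation of \<open>harm k - euler_mascheroni - ln (y / 2)\<close>. With \<open>r = y / 2\<close>, from
  above \<open>ln ((k + 1) / r) \<le> (k + 1) / r - 1\<close>, and \<open>k / r \<le> (k\<^sup>2 / r\<^sup>2 + 1) / 2\<close> reduces the first
  moment to the second. The lower bound applies the same two inequalities to the reciprocal
  \<open>u = r / (k + 1)\<close>.
\<close>

lemma modified_K0_le:
  assumes "y > 0"
  shows "modified_K0 y \<le> 2 / y * modified_I0 y"
proof -
  define r where "r = y / 2"
  have r: "r > 0" using assms by (simp add: r_def)
  have le: "bessel_weight y k * (harm k - euler_mascheroni - ln (y / 2))
      \<le> 1 / (2 * r\<^sup>2) * ((real k)\<^sup>2 * bessel_weight y k) + (1 / r - 1 / 2) * bessel_weight y k" for k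
  proof -
    have "harm k - euler_mascheroni - ln (y / 2) \<le> ln (real (Suc k) / r)"
      using harm_euler_mascheroni_bounds(1)[of k] r
      by (simp add: r_def[symmetric] ln_div del: of_nat_Suc)
    also have "\<dots> \<le> real (Suc k) / r - 1"
      using r by (intro ln_le_minus_one) auto
    also have "\<dots> \<le> 1 / (2 * r\<^sup>2) * (real k)\<^sup>2 + (1 / r - 1 / 2)"
    proof -
      have "0 \<le> (real k / r - 1)\<^sup>2" by simp
      also have "\<dots> = 2 * (1 / (2 * r\<^sup>2) * (real k)\<^sup>2 + 1 / 2 - real k / r)"
        by (simp add: power2_diff power_divide)
      finally show ?thesis by (simp add: add_divide_distrib)
    qed
    finally show ?thesis
      using mult_left_mono[OF _ bessel_weight_nonneg[of y k]] by (fastforce simp: algebra_simps)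
  qed
  have "(\<lambda>k. 1 / (2 * r\<^sup>2) * ((real k)\<^sup>2 * bessel_weight y k) + (1 / r - 1 / 2) * bessel_weight y k)
      sums (1 / (2 * r\<^sup>2) * (r\<^sup>2 * modified_I0 y) + (1 / r - 1 / 2) * modified_I0 y)"
    unfolding r_def by (intro sums_add sums_mult modified_I0_sums modified_I0_second_moment)
  from sums_le[OF le modified_K0_sums this] have "modified_K0 y \<le> 1 / (2 * r\<^sup>2) * (r\<^sup>2 * modified_I0 y) + (1 / r - 1 / 2) * modified_I0 y"
    by simp
  also have "\<dots> = 1 / r * modified_I0 y" using r by (simp add: field_simps)
  finally show ?thesis by (simp add: r_def)
qed

lemma modified_K0_ge:
  assumes "y > 0"
  shows "modified_K0 y \<ge> - (2 / y) * modified_I0 y"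
proof -
  define r where "r = y / 2"
  have r: "r > 0" using assms by (simp add: r_def)
  \<comment> \<open>With \<open>u = r / (k + 1)\<close>, the loss \<open>u\<close> and the correction \<open>1 / (k + 1) = u / r\<close> are together at most \<open>a (1 + u\<^sup>2)\<close>.\<close>
  define a where "a = (1 + 1 / r) / 2"
  have le: "(1 - a) * bessel_weight y k - a * ((y / 2 / real (Suc k))\<^sup>2 * bessel_weight y k)
      \<le> bessel_weight y k * (harm k - euler_mascheroni - ln (y / 2))" for k
  proof -
    define u where "u = r / real (Suc k)"
    have u: "u > 0" using r by (simp add: u_def)
    have "1 - a - a * u\<^sup>2 \<le> 1 - u - u / r"
    proof -
      have "a * (2 * u) \<le> a * (1 + u\<^sup>2)"
        using r sum_squares_ge_zero[of "u - 1" 0]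
        by (intro mult_left_mono) (auto simp: a_def power2_eq_square algebra_simps)
      then show ?thesis using r by (simp add: a_def algebra_simps add_divide_distrib)
    qed
    also have "1 - u \<le> - ln u" using ln_le_minus_one[OF u] by simp
    also have "- ln u - u / r \<le> harm k - euler_mascheroni - ln (y / 2)"
      using harm_euler_mascheroni_bounds(2)[of k] r
      by (simp add: u_def ln_div r_def[symmetric] del: of_nat_Suc)
    finally show ?thesis
      using mult_left_mono[OF _ bessel_weight_nonneg[of y k]]
      by (fastforce simp: u_def r_def algebra_simps simp del: of_nat_Suc)
  qed
  have "(\<lambda>k. (1 - a) * bessel_weight y k - a * ((y / 2 / real (Suc k))\<^sup>2 * bessel_weight y k))
      sums ((1 - a) * modified_I0 y - a * (modified_I0 y - 1))"
    by (intro sums_diff sums_mult modified_I0_sums modified_I0_inverse_second_moment assms)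
  from sums_le[OF le this modified_K0_sums]
  have "(1 - a) * modified_I0 y - a * (modified_I0 y - 1) \<le> modified_K0 y" .
  moreover have "(1 - a) * modified_I0 y - a * (modified_I0 y - 1) \<ge> - (1 / r) * modified_I0 y"
    using r by (simp add: a_def field_simps)
  ultimately show ?thesis by (simp add: r_def)
qed

lemma modified_bessel_derivatives:
  obtains I' K' where
    "\<And>y. y > 0 \<Longrightarrow> (modified_I0 has_real_derivative I' y) (at y)"
    "\<And>y. y > 0 \<Longrightarrow> (I' has_real_derivative modified_I0 y - I' y / y) (at y)"
    "\<And>y. y > 0 \<Longrightarrow> (modified_K0 has_real_derivative K' y) (at y)"
    "\<And>y. y > 0 \<Longrightarrow> (K' has_real_derivative modified_K0 y - K' y / y) (at y)"
proof -
  obtain J' H' where JH: "bessel_eq bessel_J0 J'" "bessel_eq hankel1_0 H'"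
    by (rule bessel_J0_hankel1_0_solve_bessel_eq)
  define a where "a = \<i> * of_real pi / 2"
  define I' where "I' y = Re (1 * \<i> * J' (\<i> * of_real y))" for y
  define K' where "K' y = Re (a * \<i> * H' (\<i> * of_real y))" for y
  have I: "modified_I0 = (\<lambda>y. Re (1 * bessel_J0 (\<i> * of_real y)))"
    by (simp add: bessel_J0_imaginary)
  have K: "Re (a * hankel1_0 (\<i> * of_real y)) = modified_K0 y" if "y > 0" for y
    using that by (simp add: a_def hankel1_0_imaginary)
  show ?thesis
  proof
    fix y :: real assume y: "y > 0"
    show "(modified_I0 has_real_derivative I' y) (at y)"
      unfolding I I'_def by (rule bessel_eq_imaginary_axis(1)[OF JH(1) y])
    show "(I' has_real_derivative modified_I0 y - I' y / y) (at y)"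
      unfolding I I'_def[abs_def] by (rule bessel_eq_imaginary_axis(2)[OF JH(1) y])
    have "((\<lambda>y. Re (a * hankel1_0 (\<i> * of_real y))) has_real_derivative K' y) (at y)"
      unfolding K'_def by (rule bessel_eq_imaginary_axis(1)[OF JH(2) y])
    then show "(modified_K0 has_real_derivative K' y) (at y)"
      by (rule has_field_derivative_transform_within_open[of _ _ _ "{0<..}"]) (use y K in auto)
    show "(K' has_real_derivative modified_K0 y - K' y / y) (at y)"
      using bessel_eq_imaginary_axis(2)[OF JH(2) y, of a] K[OF y]
      unfolding K'_def[abs_def] by simp
  qed
qed

lemma modified_K0_over_I0_tendsto_0: "((\<lambda>y. modified_K0 y / modified_I0 y) \<longlongrightarrow> 0) at_top"
proof (rule Lim_null_comparison)
  show "\<forall>\<^sub>F y in at_top. norm (modified_K0 y / modified_I0 y) \<le> 2 / y"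
    using eventually_gt_at_top[of 0]
  proof eventually_elim
    case (elim y)
    have "\<bar>modified_K0 y\<bar> \<le> 2 / y * modified_I0 y"
      using modified_K0_le[OF elim] modified_K0_ge[OF elim] by simp
    then show ?case using modified_I0_ge_1[of y] by (simp add: field_simps)
  qed
  show "((\<lambda>y::real. 2 / y) \<longlongrightarrow> 0) at_top" by real_asymp
qed

text \<open>
  By Abel's identity the derivative of \<open>K\<^sub>0 / I\<^sub>0\<close> has the constant sign of \<open>D\<close>, so the quotient is
  monotone. It is positive near \<open>0\<close> by the logarithm and tends to \<open>0\<close> at infinity, so it decreases
  and stays positive.
\<close>

lemma modified_K0_pos:
  assumes "y > 0"
  shows "modified_K0 y > 0"
proof -
  obtain I' K' where
    I: "\<And>y. y > 0 \<Longrightarrow> (modified_I0 has_real_derivative I' y) (at y)"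
       "\<And>y. y > 0 \<Longrightarrow> (I' has_real_derivative modified_I0 y - I' y / y) (at y)" and
    K: "\<And>y. y > 0 \<Longrightarrow> (modified_K0 has_real_derivative K' y) (at y)"
       "\<And>y. y > 0 \<Longrightarrow> (K' has_real_derivative modified_K0 y - K' y / y) (at y)"
    by (rule modified_bessel_derivatives) (rule that)
  define W where "W y = y * (K' y * modified_I0 y - modified_K0 y * I' y)" for y
  define D where "D = W 1"
  have "(W has_real_derivative 0) (at y)" if "y > 0" for y
    unfolding W_def[abs_def]
    by (rule DERIV_cong[OF DERIV_mult[OF DERIV_ident DERIV_diff[OF
            DERIV_mult[OF K(2)[OF that] I(1)[OF that]] DERIV_mult[OF K(1)[OF that] I(2)[OF that]]]]])
       (use that in \<open>simp add: field_simps\<close>)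
  then have W: "W y = D" if "y > 0" for y
    unfolding D_def using that
    by (intro DERIV_isconst3[of 0 "max y 1 + 1"]) auto
  define g where "g y = modified_K0 y / modified_I0 y" for y
  have Ipos: "modified_I0 y > 0" for y using modified_I0_ge_1[of y] by simp
  have g': "(g has_real_derivative D / (y * (modified_I0 y)\<^sup>2)) (at y)" if "y > 0" for y
  proof -
    have "(g has_real_derivative (K' y * modified_I0 y - modified_K0 y * I' y) / (modified_I0 y)\<^sup>2) (at y)"
      unfolding g_def[abs_def] power2_eq_square
      by (rule DERIV_divide) (use K I that Ipos[of y] in auto)
    also have "K' y * modified_I0 y - modified_K0 y * I' y = D / y"
      using W[OF that] that by (simp add: W_def field_simps)
    finally show ?thesis by simp
  qed
  have sgn: "D / (y * (modified_I0 y)\<^sup>2) < 0 \<longleftrightarrow> D < 0" if "y > 0" for y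
  proof -
    have "y * (modified_I0 y)\<^sup>2 > 0" using that Ipos[of y] by simp
    then show ?thesis unfolding divide_less_0_iff by linarith
  qed
  have lim: "(g \<longlongrightarrow> 0) at_top"
    unfolding g_def[abs_def] by (rule modified_K0_over_I0_tendsto_0)
  \<comment> \<open>A point below \<open>y\<close> so small that every term of the series of \<open>K\<^sub>0\<close> is at least its weight.\<close>
  define x where "x = min (y / 2) (2 * exp (- euler_mascheroni - 1) :: real)"
  have x: "x > 0" "x < y" using assms by (auto simp: x_def min_def)
  have "ln (x / 2) \<le> - euler_mascheroni - 1"
  proof -
    have "ln (x / 2) \<le> ln (exp (- euler_mascheroni - 1) :: real)"
      using x by (subst ln_le_cancel_iff) (auto simp: x_def)
    then show ?thesis by simp
  qed
  have "modified_K0 x > 0"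
  proof -
    have "bessel_weight x k \<le> bessel_weight x k * (harm k - euler_mascheroni - ln (x / 2))" for k
      using mult_left_mono[OF _ bessel_weight_nonneg, of 1 "harm k - euler_mascheroni - ln (x / 2)" x k]
        \<open>ln (x / 2) \<le> _\<close> harm_nonneg[of k, where 'a = real] by simp
    from sums_le[OF this modified_I0_sums modified_K0_sums] Ipos[of x] show ?thesis by simp
  qed
  then have gx: "g x > 0" using Ipos[of x] by (simp add: g_def)
  have "D < 0"
  proof (rule ccontr)
    assume "\<not> D < 0"
    have "g x \<le> g t" if "t \<ge> x" for t
    proof (rule DERIV_nonneg_imp_nondecreasing[OF that])
      fix r :: real assume "x \<le> r" "r \<le> t"
      then have "r > 0" using x by simp
      then show "\<exists>l. (g has_real_derivative l) (at r) \<and> 0 \<le> l"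
        using g'[of r] sgn[of r] \<open>\<not> D < 0\<close> by (auto simp: not_less)
    qed
    then have "\<forall>\<^sub>F t in at_top. g x \<le> g t" by (auto intro: eventually_at_top_linorderI)
    with lim have "g x \<le> 0" by (intro tendsto_lowerbound) auto
    with gx show False by simp
  qed
  have "g (y + 1) < g y"
  proof (rule DERIV_neg_imp_decreasing[of y "y + 1" g])
    fix r assume "y \<le> r" "r \<le> y + 1"
    then have "r > 0" using assms by simp
    then show "\<exists>l. (g has_real_derivative l) (at r) \<and> l < 0"
      using g'[of r] sgn[of r] \<open>D < 0\<close> by blast
  qed simp
  moreover have "g (y + 1) \<ge> 0"
  proof -
    have "g t \<le> g (y + 1)" if "t \<ge> y + 1" for t
    proof (rule DERIV_nonpos_imp_nonincreasing[OF that])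
      fix r assume "y + 1 \<le> r" "r \<le> t"
      then have "r > 0" using assms by simp
      then show "\<exists>l. (g has_real_derivative l) (at r) \<and> l \<le> 0"
        using g'[of r] sgn[of r] \<open>D < 0\<close> by (auto intro: less_imp_le)
    qed
    then have "\<forall>\<^sub>F t in at_top. g t \<le> g (y + 1)" by (auto intro: eventually_at_top_linorderI)
    with lim show ?thesis by (intro tendsto_upperbound) auto
  qed
  ultimately have "g y > 0" by simp
  then show ?thesis using Ipos[of y] by (simp add: g_def zero_less_divide_iff)
qed

text \<open>
  The leading behaviour \<open>exp (- y) / sqrt y\<close> is divided out; what remains solves
  \<open>V'' = 2 V' - V / (4 y\<^sup>2)\<close>. Its solutions are asymptotically constant or grow like \<open>exp (2 y)\<close>.
\<close>

definition scaled_K0 :: "real \<Rightarrow> real" where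
  "scaled_K0 y = sqrt y * exp y * modified_K0 y"

lemma scaled_K0_derivatives:
  obtains V' where
    "\<And>y. y > 0 \<Longrightarrow> (scaled_K0 has_real_derivative V' y) (at y)"
    "\<And>y. y > 0 \<Longrightarrow> (V' has_real_derivative 2 * V' y - scaled_K0 y / (4 * y\<^sup>2)) (at y)"
proof -
  obtain I' K' where
    I: "\<And>y. y > 0 \<Longrightarrow> (modified_I0 has_real_derivative I' y) (at y)"
       "\<And>y. y > 0 \<Longrightarrow> (I' has_real_derivative modified_I0 y - I' y / y) (at y)" and
    K: "\<And>y. y > 0 \<Longrightarrow> (modified_K0 has_real_derivative K' y) (at y)"
       "\<And>y. y > 0 \<Longrightarrow> (K' has_real_derivative modified_K0 y - K' y / y) (at y)"
    by (rule modified_bessel_derivatives) (rule that)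
  define E where "E y = sqrt y * exp y" for y
  define V' where "V' y = E y * modified_K0 y * (1 + 1 / (2 * y)) + E y * K' y" for y
  have E: "(E has_real_derivative E y * (1 + 1 / (2 * y))) (at y)" if "y > 0" for y
    unfolding E_def[abs_def] using that
    by (auto intro!: derivative_eq_intros simp: field_simps)
  have h: "((\<lambda>y. 1 + 1 / (2 * y)) has_real_derivative - 1 / (2 * y\<^sup>2)) (at y)" if "y > 0" for y
    using that by (auto intro!: derivative_eq_intros simp: field_simps power2_eq_square)
  show ?thesis
  proof
    fix y :: real assume y: "y > 0"
    show "(scaled_K0 has_real_derivative V' y) (at y)"
      unfolding scaled_K0_def[abs_def] E_def[symmetric]
      by (rule DERIV_cong[OF DERIV_mult[OF E[OF y] K(1)[OF y]]])
         (simp add: V'_def algebra_simps)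
    show "(V' has_real_derivative 2 * V' y - scaled_K0 y / (4 * y\<^sup>2)) (at y)"
      unfolding V'_def[abs_def] scaled_K0_def E_def[symmetric]
      by (rule DERIV_cong[OF DERIV_add[OF DERIV_mult[OF DERIV_mult[OF E[OF y] K(1)[OF y]] h[OF y]]
             DERIV_mult[OF E[OF y] K(2)[OF y]]]])
         (use y in \<open>simp add: field_simps power2_eq_square\<close>)
  qed
qed

lemma scaled_K0_pos: "y > 0 \<Longrightarrow> scaled_K0 y > 0"
  by (simp add: scaled_K0_def modified_K0_pos)

text \<open>
  This crude bound misses the growth \<open>exp (2 y)\<close> of the dominant solutions by a factor tending to \<open>0\<close>,
  which is enough to exclude them.
\<close>

lemma scaled_K0_le:
  assumes "y \<ge> 1"
  shows "scaled_K0 y \<le> 2 / sqrt y * exp (2 * y)"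
proof -
  have "modified_K0 y \<le> 2 / y * exp y"
    using modified_K0_le[of y] modified_I0_le_exp[of y] assms
      mult_left_mono[of "modified_I0 y" "exp y" "2 / y"] by simp
  then have "scaled_K0 y \<le> sqrt y * exp y * (2 / y * exp y)"
    unfolding scaled_K0_def using assms by (intro mult_left_mono) auto
  also have "\<dots> = 2 / sqrt y * exp (2 * y)"
    using assms by (simp add: field_simps flip: exp_add)
  finally show ?thesis .
qed

text \<open>
  Positivity makes \<open>exp (- 2 y) V'\<close> decreasing, so \<open>V' \<ge> 0\<close>: a negative slope would persist and make
  \<open>V\<close> negative. In the other direction, \<open>q = V' - V / (4 y\<^sup>2)\<close> can never become positive for
  \<open>y \<ge> 1\<close>, since it would then grow like \<open>exp (2 y)\<close>, which the crude bound forbids. Hence the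
  logarithm of \<open>V\<close> has derivative between \<open>0\<close> and \<open>1 / (4 y\<^sup>2)\<close>.
\<close>

lemma scaled_K0_bounds:
  obtains V' c C where "0 < c" "0 < C"
    "\<And>y. y > 0 \<Longrightarrow> (scaled_K0 has_real_derivative V' y) (at y)"
    "\<And>y. y \<ge> 1 \<Longrightarrow> c \<le> scaled_K0 y" "\<And>y. y \<ge> 1 \<Longrightarrow> scaled_K0 y \<le> C"
    "\<And>y. y \<ge> 1 \<Longrightarrow> \<bar>V' y\<bar> \<le> C / y\<^sup>2"
proof -
  obtain V' where V:
    "\<And>y. y > 0 \<Longrightarrow> (scaled_K0 has_real_derivative V' y) (at y)"
    "\<And>y. y > 0 \<Longrightarrow> (V' has_real_derivative 2 * V' y - scaled_K0 y / (4 * y\<^sup>2)) (at y)"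
    by (rule scaled_K0_derivatives) (rule that)
  have V'_nonneg: "V' y \<ge> 0" if "y > 0" for y
  proof (rule ccontr)
    assume neg: "\<not> V' y \<ge> 0"
    define w where "w t = exp (- 2 * t) * V' t" for t
    have le: "V' t \<le> V' y" if t: "t \<ge> y" for t
    proof -
      have "w t \<le> w y"
      proof (rule DERIV_nonpos_imp_nonincreasing[OF t])
        fix r assume "y \<le> r" "r \<le> t"
        then have r: "r > 0" using \<open>y > 0\<close> by simp
        have e: "((\<lambda>t::real. exp (- 2 * t)) has_real_derivative - 2 * exp (- 2 * r)) (at r)"
          by (auto intro!: derivative_eq_intros)
        have "(w has_real_derivative - exp (- 2 * r) * (scaled_K0 r / (4 * r\<^sup>2))) (at r)"
          unfolding w_def[abs_def]
          by (rule DERIV_cong[OF DERIV_mult[OF e V(2)[OF r]]]) (simp add: algebra_simps)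
        moreover have "- exp (- 2 * r) * (scaled_K0 r / (4 * r\<^sup>2)) \<le> 0"
          using scaled_K0_pos[OF r] by (simp add: mult_nonneg_nonneg)
        ultimately show "\<exists>l. (w has_real_derivative l) (at r) \<and> l \<le> 0" by blast
      qed
      then have "V' t \<le> exp (2 * (t - y)) * V' y"
        by (simp add: w_def exp_minus exp_diff field_simps right_diff_distrib)
      also have "\<dots> \<le> 1 * V' y"
        using t neg by (intro mult_right_mono_neg) auto
      finally show ?thesis by simp
    qed
    \<comment> \<open>The tangent at \<open>y\<close> reaches \<open>0\<close> here.\<close>
    define t where "t = y + scaled_K0 y / - V' y"
    have t: "t > y" using neg scaled_K0_pos[OF \<open>y > 0\<close>] by (simp add: t_def divide_pos_neg)
    have "scaled_K0 t - V' y * t \<le> scaled_K0 y - V' y * y"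
    proof (intro DERIV_nonpos_imp_nonincreasing[of y t "\<lambda>t. scaled_K0 t - V' y * t"])
      fix r assume *: "y \<le> r" "r \<le> t"
      then have "((\<lambda>t. scaled_K0 t - V' y * t) has_real_derivative V' r - V' y) (at r)"
        using V(1)[of r] \<open>y > 0\<close> by (auto intro!: derivative_eq_intros)
      then show "\<exists>l. ((\<lambda>t. scaled_K0 t - V' y * t) has_real_derivative l) (at r) \<and> l \<le> 0"
        using le[OF *(1)] by force
    qed (use t in auto)
    moreover have "V' y * (t - y) = - scaled_K0 y" using neg by (simp add: t_def)
    ultimately have "scaled_K0 t \<le> 0" by (simp add: algebra_simps)
    with scaled_K0_pos[of t] t \<open>y > 0\<close> show False by simp
  qed
  define q where "q y = V' y - scaled_K0 y / (4 * y\<^sup>2)" for y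
  have d2: "((\<lambda>y. 1 / (4 * y\<^sup>2)) has_real_derivative - 1 / (2 * y ^ 3)) (at y)" if "y > 0" for y :: real
    using that by (auto intro!: derivative_eq_intros simp: field_simps power2_eq_square power3_eq_cube)
  have q': "(q has_real_derivative (2 - 1 / (4 * y\<^sup>2)) * q y
      + scaled_K0 y * (1 / (4 * y\<^sup>2) + 1 / (2 * y ^ 3) - 1 / (16 * y ^ 4))) (at y)" if "y > 0" for y
  proof -
    have "q = (\<lambda>y. V' y - scaled_K0 y * (1 / (4 * y\<^sup>2)))" by (simp add: q_def fun_eq_iff)
    then have "(q has_real_derivative 2 * V' y - scaled_K0 y / (4 * y\<^sup>2)
        - (V' y * (1 / (4 * y\<^sup>2)) + - 1 / (2 * y ^ 3) * scaled_K0 y)) (at y)"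
      using DERIV_diff[OF V(2)[OF that] DERIV_mult[OF V(1)[OF that] d2[OF that]]] by simp
    also have "2 * V' y - scaled_K0 y / (4 * y\<^sup>2)
        - (V' y * (1 / (4 * y\<^sup>2)) + - 1 / (2 * y ^ 3) * scaled_K0 y) = (2 - 1 / (4 * y\<^sup>2)) * q y
      + scaled_K0 y * (1 / (4 * y\<^sup>2) + 1 / (2 * y ^ 3) - 1 / (16 * y ^ 4))"
      using that by (simp add: q_def field_simps eval_nat_numeral)
    finally show ?thesis .
  qed
  have q_le: "q y \<le> 0" if y: "y \<ge> 1" for y
  proof (rule ccontr)
    assume "\<not> q y \<le> 0"
    \<comment> \<open>The integrating factor of the inequality \<open>q' \<ge> (2 - 1 / (4 t\<^sup>2)) q\<close>.\<close>
    define w where "w t = exp (- 2 * t - 1 / (4 * t)) * q t" for t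
    have w: "w y > 0" using \<open>\<not> q y \<le> 0\<close> by (simp add: w_def)
    have V'_ge: "V' t \<ge> w y * exp (2 * t)" if t: "t \<ge> y" for t
    proof -
      have "w y \<le> w t"
      proof (rule DERIV_nonneg_imp_nondecreasing[OF t])
        fix r assume "y \<le> r" "r \<le> t"
        then have r: "r \<ge> 1" using y by simp
        define e where "e = exp (- 2 * r - 1 / (4 * r))"
        define Q where "Q = scaled_K0 r * (1 / (4 * r\<^sup>2) + 1 / (2 * r ^ 3) - 1 / (16 * r ^ 4))"
        have e: "((\<lambda>t::real. exp (- 2 * t - 1 / (4 * t))) has_real_derivative
            (1 / (4 * r\<^sup>2) - 2) * e) (at r)"
          using r by (auto intro!: derivative_eq_intros simp: e_def field_simps power2_eq_square)
        have "(w has_real_derivative e * Q) (at r)"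
          unfolding w_def[abs_def]
          by (rule DERIV_cong[OF DERIV_mult[OF e q']])
             (use r in simp, simp only: Q_def[symmetric] e_def[symmetric], simp add: algebra_simps)
        moreover have "Q \<ge> 0"
        proof -
          have "1 / (16 * r ^ 4) \<le> 1 / (4 * r\<^sup>2)"
          proof (rule divide_left_mono)
            show "4 * r\<^sup>2 \<le> 16 * r ^ 4"
              using r power_increasing[of 2 4 r] zero_le_power[of r 4] by linarith
          qed (use r in auto)
          moreover have "0 \<le> 1 / (2 * r ^ 3)" using r by simp
          ultimately have "0 \<le> 1 / (4 * r\<^sup>2) + 1 / (2 * r ^ 3) - 1 / (16 * r ^ 4)"
            by linarith
          then show ?thesis
            using r scaled_K0_pos[of r] unfolding Q_def by (intro mult_nonneg_nonneg) auto
        qed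
        ultimately show "\<exists>l. (w has_real_derivative l) (at r) \<and> 0 \<le> l"
          unfolding e_def by (metis exp_ge_zero mult_nonneg_nonneg)
      qed
      then have "w y * exp (2 * t) \<le> w t * exp (2 * t)" by simp
      also have "\<dots> = exp (- (1 / (4 * t))) * q t" 
        by (simp add: w_def mult_exp_exp algebra_simps)
      also have "\<dots> \<le> 1 * q t"
      proof (rule mult_right_mono)
        have "w t > 0" using w \<open>w y \<le> w t\<close> by simp
        then show "q t \<ge> 0" by (simp add: w_def zero_less_mult_iff)
      qed (use t y in auto)
      also have "\<dots> \<le> V' t" using t y scaled_K0_pos[of t] by (simp add: q_def)
      finally show ?thesis .
    qed
    define \<delta> where "\<delta> = w y / 2"
    have "\<delta> > 0" using w by (simp add: \<delta>_def)
    define M where "M = \<delta> * exp (2 * y) - scaled_K0 y"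
    have "\<delta> * exp (2 * t) - M \<le> 2 / sqrt t * exp (2 * t)" if t: "t \<ge> y" for t
    proof -
      have "scaled_K0 y - \<delta> * exp (2 * y) \<le> scaled_K0 t - \<delta> * exp (2 * t)"
      proof (rule DERIV_nonneg_imp_nondecreasing[OF t])
        fix r assume r: "y \<le> r" "r \<le> t"
        then have "((\<lambda>t. scaled_K0 t - \<delta> * exp (2 * t)) has_real_derivative
            V' r - 2 * \<delta> * exp (2 * r)) (at r)"
          using V(1)[of r] y by (auto intro!: derivative_eq_intros)
        then show "\<exists>l. ((\<lambda>t. scaled_K0 t - \<delta> * exp (2 * t)) has_real_derivative l) (at r) \<and> 0 \<le> l"
          using V'_ge[OF r(1)] unfolding \<delta>_def by force
      qed
      then show ?thesis using scaled_K0_le[of t] t y by (simp add: M_def)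
    qed
    then have "\<forall>\<^sub>F t in at_top. \<delta> * exp (2 * t) - M \<le> 2 / sqrt t * exp (2 * t)"
      by (auto intro: eventually_at_top_linorderI)
    moreover have "\<forall>\<^sub>F t in at_top. \<delta> * exp (2 * t) - M > 2 / sqrt t * exp (2 * t)"
      using \<open>\<delta> > 0\<close> by real_asymp
    ultimately have "\<forall>\<^sub>F t::real in at_top. False" by eventually_elim simp
    then show False by simp
  qed
  have V'_le: "V' y \<le> scaled_K0 y / (4 * y\<^sup>2)" if "y \<ge> 1" for y
    using q_le[OF that] by (simp add: q_def)
  define C where "C = scaled_K0 1 * exp (1 / 4)"
  have "C > 0" using scaled_K0_pos[of 1] by (simp add: C_def)
  have ge: "scaled_K0 1 \<le> scaled_K0 y" if "y \<ge> 1" for y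
  proof (rule DERIV_nonneg_imp_nondecreasing[OF that])
    fix r :: real assume "1 \<le> r" "r \<le> y"
    then show "\<exists>l. (scaled_K0 has_real_derivative l) (at r) \<and> 0 \<le> l"
      using V(1)[of r] V'_nonneg[of r] by auto
  qed
  have le: "scaled_K0 y \<le> C" if y: "y \<ge> 1" for y
  proof -
    have "scaled_K0 y * exp (1 / (4 * y)) \<le> scaled_K0 1 * exp (1 / (4 * 1))"
    proof (rule DERIV_nonpos_imp_nonincreasing[OF y])
      fix r assume r: "1 \<le> r" "r \<le> y"
      have e: "((\<lambda>t::real. exp (1 / (4 * t))) has_real_derivative
            - (1 / (4 * r\<^sup>2)) * exp (1 / (4 * r))) (at r)"
        using r by (auto intro!: derivative_eq_intros simp: field_simps power2_eq_square)
      have "((\<lambda>t. scaled_K0 t * exp (1 / (4 * t))) has_real_derivative exp (1 / (4 * r)) * q r) (at r)"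
        by (rule DERIV_cong[OF DERIV_mult[OF V(1) e]]) (use r in \<open>auto simp: q_def algebra_simps\<close>)
      moreover have "exp (1 / (4 * r)) * q r \<le> 0"
        using q_le[of r] r by (simp add: mult_nonneg_nonpos)
      ultimately show "\<exists>l. ((\<lambda>t. scaled_K0 t * exp (1 / (4 * t))) has_real_derivative l) (at r) \<and> l \<le> 0"
        by blast
    qed
    moreover have "scaled_K0 y * 1 \<le> scaled_K0 y * exp (1 / (4 * y))"
      using y scaled_K0_pos[of y] by (intro mult_left_mono) auto
    ultimately show ?thesis by (simp add: C_def)
  qed
  show ?thesis
  proof (rule that[of "scaled_K0 1" C V'])
    fix y :: real assume y: "y \<ge> 1"
    have "V' y \<le> scaled_K0 y / (4 * y\<^sup>2)" by (rule V'_le[OF y])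
    also have "\<dots> \<le> C / (4 * y\<^sup>2)" using le[OF y] by (intro divide_right_mono) auto
    also have "\<dots> \<le> C / y\<^sup>2" using \<open>C > 0\<close> y by (intro divide_left_mono) auto
    finally show "\<bar>V' y\<bar> \<le> C / y\<^sup>2" using V'_nonneg[of y] y by simp
  qed (use V ge le \<open>C > 0\<close> scaled_K0_pos in auto)
qed

section \<open>The Hankel function in the first quadrant\<close>

lemma has_field_derivative_csqrt_logarithmic:
  assumes "Im z > 0"
  shows "(csqrt has_field_derivative csqrt z / (2 * z)) (at z)"
proof -
  have z: "z \<notin> \<real>\<^sub>\<le>\<^sub>0" "z \<noteq> 0" using assms by (auto simp: complex_nonpos_Reals_iff)
  have "inverse (2 * csqrt z) = csqrt z / (2 * (csqrt z)\<^sup>2)"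
    using z by (simp add: field_simps power2_eq_square)
  then show ?thesis
    using has_field_derivative_csqrt[OF z(1)] by (simp only: power2_csqrt)
qed

text \<open>
  Dividing out the leading behaviour \<open>exp (\<i> z) / csqrt z\<close> leads to
  \<open>v'' = - 2 \<i> v' - v / (4 z\<^sup>2)\<close>, whose solutions are asymptotically constant or behave like
  \<open>exp (- 2 \<i> z)\<close>.
\<close>

definition scaled_hankel :: "complex \<Rightarrow> complex" where
  "scaled_hankel z = csqrt z * exp (- \<i> * z) * hankel1_0 z"

lemma scaled_hankel_derivatives:
  obtains v' where
    "\<And>z. Im z > 0 \<Longrightarrow> (scaled_hankel has_field_derivative v' z) (at z)"
    "\<And>z. Im z > 0 \<Longrightarrow>
      (v' has_field_derivative - 2 * \<i> * v' z - scaled_hankel z / (4 * z\<^sup>2)) (at z)"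
proof -
  obtain J' H' where JH: "bessel_eq bessel_J0 J'" "bessel_eq hankel1_0 H'"
    by (rule bessel_J0_hankel1_0_solve_bessel_eq)
  have H: "(hankel1_0 has_field_derivative H' z) (at z)"
          "(H' has_field_derivative - hankel1_0 z - H' z / z) (at z)" if "Im z > 0" for z
    using JH(2) that unfolding bessel_eq_def by auto
  define E where "E z = csqrt z * exp (- \<i> * z)" for z
  define v' where "v' z = E z * hankel1_0 z * (1 / (2 * z) - \<i>) + E z * H' z" for z
  have E: "(E has_field_derivative E z * (1 / (2 * z) - \<i>)) (at z)" if "Im z > 0" for z
  proof -
    note s = has_field_derivative_csqrt_logarithmic[OF that]
    have e: "((\<lambda>z. exp (- \<i> * z)) has_field_derivative - \<i> * exp (- \<i> * z)) (at z)"
      by (auto intro!: derivative_eq_intros)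
    show ?thesis
      unfolding E_def[abs_def] by (rule DERIV_cong[OF DERIV_mult[OF s e]]) (simp add: field_simps)
  qed
  have h: "((\<lambda>z. 1 / (2 * z) - \<i>) has_field_derivative - 1 / (2 * z\<^sup>2)) (at z)" if "Im z > 0" for z
  proof -
    have nz: "z \<noteq> 0" using that by auto
    then show ?thesis by (auto intro!: derivative_eq_intros simp: field_simps power2_eq_square)
  qed
  show ?thesis
  proof
    fix z :: complex assume z: "Im z > 0"
    then have nz: "z \<noteq> 0" by auto
    show "(scaled_hankel has_field_derivative v' z) (at z)"
      unfolding scaled_hankel_def[abs_def] E_def[symmetric]
      by (rule DERIV_cong[OF DERIV_mult[OF E[OF z] H(1)[OF z]]])
         (simp add: v'_def algebra_simps)
    show "(v' has_field_derivative - 2 * \<i> * v' z - scaled_hankel z / (4 * z\<^sup>2)) (at z)"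
      unfolding v'_def[abs_def] scaled_hankel_def E_def[symmetric]
      by (rule DERIV_cong[OF DERIV_add[OF DERIV_mult[OF DERIV_mult[OF E[OF z] H(1)[OF z]] h[OF z]]
             DERIV_mult[OF E[OF z] H(2)[OF z]]]])
         (use nz in \<open>simp add: field_simps power2_eq_square\<close>)
  qed
qed

lemma scaled_hankel_imaginary:
  assumes "y > 0"
  shows "scaled_hankel (\<i> * of_real y) =
    csqrt \<i> * (- 2 * \<i> / of_real pi) * of_real (scaled_K0 y)"
proof -
  have "csqrt (\<i> * of_real y) = csqrt \<i> * of_real (sqrt y)"
  proof (rule csqrt_unique)
    show "(csqrt \<i> * of_real (sqrt y))\<^sup>2 = \<i> * of_real y"
      using assms by (simp add: power_mult_distrib del: csqrt_ii flip: of_real_power)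
  qed (use assms in simp)
  then show ?thesis
    using assms
    by (simp del: csqrt_ii add: scaled_hankel_def hankel1_0_imaginary scaled_K0_def exp_of_real)
qed

text \<open>
  Bounds on the imaginary axis propagate to the right along horizontal lines, where
  \<open>exp (2 \<i> z)\<close> has constant modulus. With \<open>p = v'\<close> and \<open>m = v' + 2 \<i> v\<close>, the derivatives of
  \<open>exp (2 \<i> x) p\<close> and of \<open>m\<close> are bounded by \<open>\<bar>v\<bar> / (4 (x\<^sup>2 + y\<^sup>2))\<close>, whose integral over the whole
  line is of order \<open>sup \<bar>v\<bar> / y\<close>. As \<open>2 \<i> v = m - p\<close>, the supremum is controlled by the values at
  \<open>x = 0\<close>.
\<close>

lemma horizontal_line_bounds:
  fixes v v' :: "complex \<Rightarrow> complex"
  assumes v: "\<And>z. Im z > 0 \<Longrightarrow> (v has_field_derivative v' z) (at z)"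
    and v': "\<And>z. Im z > 0 \<Longrightarrow> (v' has_field_derivative - 2 * \<i> * v' z - v z / (4 * z\<^sup>2)) (at z)"
    and y: "y \<ge> 1" and X: "X \<ge> 0"
  defines "u0 \<equiv> norm (v (Complex 0 y))" and "p0 \<equiv> norm (v' (Complex 0 y))"
  shows "norm (v (Complex X y)) \<le> 2 * (u0 + p0)"
    and "norm (v' (Complex X y)) \<le> p0 + (u0 + p0) / y"
    and "norm (v (Complex X y)) \<ge> u0 - p0 - (u0 + p0) / y"
proof -
  define u where "u x = v (Complex x y)" for x
  define p where "p x = v' (Complex x y)" for x
  have line: "((\<lambda>x. Complex x y) has_vector_derivative 1) (at x within A)" for x A
    unfolding Complex_eq by (auto intro!: derivative_eq_intros)
  have du: "(u has_vector_derivative p x) (at x within A)" for x A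
    unfolding u_def[abs_def] p_def
    using field_vector_diff_chain_within[OF line, of v "v' (Complex x y)" x A] v[of "Complex x y"] y
    by (simp add: o_def has_field_derivative_at_within)
  have dp: "(p has_vector_derivative - 2 * \<i> * p x - u x / (4 * (Complex x y)\<^sup>2)) (at x within A)" for x A
    unfolding u_def p_def[abs_def]
    using field_vector_diff_chain_within[OF line, of v' "- 2 * \<i> * v' (Complex x y) - v (Complex x y) / (4 * (Complex x y)\<^sup>2)" x A]
      v'[of "Complex x y"] y
    by (simp add: o_def has_field_derivative_at_within)
  define q where "q x = exp (2 * \<i> * of_real x) * p x" for x
  define m where "m x = p x + 2 * \<i> * u x" for x
  have dq: "(q has_vector_derivative - exp (2 * \<i> * of_real x) * u x / (4 * (Complex x y)\<^sup>2)) (at x within A)" for x A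
  proof -
    have e: "((\<lambda>x. exp (2 * \<i> * of_real x)) has_vector_derivative 2 * \<i> * exp (2 * \<i> * of_real x)) (at x within A)"
      by (rule has_vector_derivative_real_field[where f = "\<lambda>z. exp (2 * \<i> * z)"])
         (auto intro!: derivative_eq_intros)
    show ?thesis
      unfolding q_def[abs_def] using has_vector_derivative_mult[OF e dp]
      by (simp add: algebra_simps)
  qed
  have dm: "(m has_vector_derivative - u x / (4 * (Complex x y)\<^sup>2)) (at x within A)" for x A
    unfolding m_def[abs_def]
    using has_vector_derivative_add[OF dp has_vector_derivative_mult_right[OF du, of "2 * \<i>"]]
    by (simp add: algebra_simps)
  have cont: "continuous_on {0..x} f" if "\<And>x A. (f has_vector_derivative f' x) (at x within A)"
    for f f' :: "real \<Rightarrow> complex" and x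
    using that by (meson continuous_on_eq_continuous_within has_vector_derivative_continuous)
  have "\<exists>x\<in>{0..X}. \<forall>t\<in>{0..X}. norm (u t) \<le> norm (u x)"
  proof (intro continuous_attains_sup continuous_on_norm)
    show "continuous_on {0..X} u" by (rule cont) (rule du)
  qed (use X in auto)
  then obtain xm where xm: "xm \<in> {0..X}" "\<And>x. x \<in> {0..X} \<Longrightarrow> norm (u x) \<le> norm (u xm)"
    by blast
  \<comment> \<open>The primitive of the bound is an arctangent; \<open>\<pi> / 8\<close> is rounded up to \<open>1 / 2\<close> below.\<close>
  define M where "M = norm (u xm)"
  have M0: "M \<ge> 0" by (simp add: M_def)
  have nrm: "norm (u x / (4 * (Complex x y)\<^sup>2)) \<le> M / (4 * (x\<^sup>2 + y\<^sup>2))" if "x \<in> {0..X}" for x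
  proof -
    have "norm (u x / (4 * (Complex x y)\<^sup>2)) = norm (u x) / (4 * (x\<^sup>2 + y\<^sup>2))"
      by (simp add: norm_divide norm_mult norm_power cmod_power2)
    then show ?thesis using xm(2)[OF that] by (simp add: M_def divide_right_mono)
  qed
  have darctan: "((\<lambda>x. M / (4 * y) * arctan (x / y)) has_vector_derivative M / (4 * (x\<^sup>2 + y\<^sup>2))) (at x)" for x
    unfolding has_real_derivative_iff_has_vector_derivative[symmetric]
  proof -
    have "x\<^sup>2 + y\<^sup>2 > 0" using y by (simp add: add_nonneg_pos)
    then show "((\<lambda>x. M / (4 * y) * arctan (x / y)) has_real_derivative M / (4 * (x\<^sup>2 + y\<^sup>2))) (at x)"
      using y by (auto intro!: derivative_eq_intros simp: divide_simps power2_eq_square)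
  qed
  have small: "norm (f x - f 0) \<le> M / (2 * y)"
    if f: "\<And>x A. (f has_vector_derivative f' x) (at x within A)"
    and f': "\<And>x. norm (f' x) = norm (u x / (4 * (Complex x y)\<^sup>2))" and x: "x \<in> {0..X}"
    for f f' :: "real \<Rightarrow> complex" and x
  proof (cases "x = 0")
    case False
    have "norm (f x - f 0) \<le> M / (4 * y) * arctan (x / y) - M / (4 * y) * arctan (0 / y)"
    proof (rule differentiable_bound_general)
      show "continuous_on {0..x} f" by (rule cont) (rule f)
      show "continuous_on {0..x} (\<lambda>x. M / (4 * y) * arctan (x / y))"
        using y by (intro continuous_intros) auto
      show "norm (f' t) \<le> M / (4 * (t\<^sup>2 + y\<^sup>2))" if "0 < t" "t < x" for t
        unfolding f' using that x by (intro nrm) auto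
    qed (use False x f darctan in auto)
    also have "\<dots> = M / (4 * y) * arctan (x / y)" by simp
    also have "\<dots> \<le> M / (4 * y) * 2"
      using arctan_ubound[of "x / y"] pi_less_4 M0 y by (intro mult_left_mono) auto
    finally show ?thesis by simp
  qed (use M0 y in simp)
  have q: "norm (q x - q 0) \<le> M / (2 * y)" if "x \<in> {0..X}" for x
    by (rule small[OF dq _ that]) (simp add: norm_mult norm_divide)
  have m: "norm (m x - m 0) \<le> M / (2 * y)" if "x \<in> {0..X}" for x
    by (rule small[OF dm _ that]) simp
  have nq: "norm (q x) = norm (p x)" for x by (simp add: q_def norm_mult)
  have p_le: "norm (p x) \<le> p0 + M / (2 * y)" if "x \<in> {0..X}" for x
    using norm_triangle_sub[of "q x" "q 0"] q[OF that] nq by (simp add: p0_def p_def)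
  have um: "2 * \<i> * u x = m x - p x" for x by (simp add: m_def)
  have nu: "2 * norm (u x) = norm (m x - p x)" for x
    unfolding um[symmetric] by (simp add: norm_mult)
  have m0: "norm (m 0) \<le> p0 + 2 * u0" "2 * u0 - p0 \<le> norm (m 0)"
    using norm_triangle_ineq[of "p 0" "2 * \<i> * u 0"] norm_triangle_ineq2[of "2 * \<i> * u 0" "- p 0"]
    by (simp_all add: m_def p0_def u0_def p_def u_def norm_mult add.commute)
  have "2 * M \<le> norm (m xm) + norm (p xm)"
    unfolding M_def nu by (rule norm_triangle_ineq4)
  also have "norm (m xm) \<le> norm (m 0) + M / (2 * y)"
    using norm_triangle_sub[of "m xm" "m 0"] m[OF xm(1)] by simp
  finally have "2 * M \<le> 2 * u0 + 2 * p0 + M / y"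
    using m0(1) p_le[OF xm(1)] by simp
  moreover have "M / y \<le> M" using M0 y by (simp add: divide_le_eq mult_le_cancel_left1)
  ultimately have M: "M \<le> 2 * (u0 + p0)" by simp
  have XX: "X \<in> {0..X}" using X by simp
  have "norm (u X) \<le> M" unfolding M_def by (rule xm(2)[OF XX])
  then show "norm (v (Complex X y)) \<le> 2 * (u0 + p0)" using M by (simp add: u_def)
  have My: "M / (2 * y) \<le> (u0 + p0) / y" using M y by (simp add: field_simps)
  then show "norm (v' (Complex X y)) \<le> p0 + (u0 + p0) / y"
    using p_le[OF XX] by (simp add: p_def)
  have "norm (m 0) - M / (2 * y) \<le> norm (m X)"
    using norm_triangle_ineq2[of "m 0" "m X"] m[OF XX] by (simp add: norm_minus_commute)
  then have "2 * norm (u X) \<ge> 2 * u0 - p0 - M / (2 * y) - (p0 + M / (2 * y))"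
    unfolding nu using norm_triangle_ineq2[of "m X" "p X"] p_le[OF XX] m0(2) by linarith
  then show "norm (v (Complex X y)) \<ge> u0 - p0 - (u0 + p0) / y"
    using My by (simp add: u_def)
qed

lemma scaled_hankel_bounds:
  obtains v' c C y0 where "0 < c" "0 < C" "1 \<le> y0"
    "\<And>z. Im z > 0 \<Longrightarrow> (scaled_hankel has_field_derivative v' z) (at z)"
    "\<And>z. Im z \<ge> y0 \<Longrightarrow> Re z \<ge> 0 \<Longrightarrow> norm (scaled_hankel z) \<ge> c"
    "\<And>z. Im z \<ge> y0 \<Longrightarrow> Re z \<ge> 0 \<Longrightarrow> norm (scaled_hankel z) \<le> C"
    "\<And>z. Im z \<ge> y0 \<Longrightarrow> Re z \<ge> 0 \<Longrightarrow> norm (v' z) \<le> C / Im z"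
proof -
  obtain v' where v:
    "\<And>z. Im z > 0 \<Longrightarrow> (scaled_hankel has_field_derivative v' z) (at z)"
    "\<And>z. Im z > 0 \<Longrightarrow>
      (v' has_field_derivative - 2 * \<i> * v' z - scaled_hankel z / (4 * z\<^sup>2)) (at z)"
    by (rule scaled_hankel_derivatives) (rule that)
  obtain V' c C where V: "0 < c" "0 < C"
    "\<And>y. y > 0 \<Longrightarrow> (scaled_K0 has_real_derivative V' y) (at y)"
    "\<And>y. y \<ge> 1 \<Longrightarrow> c \<le> scaled_K0 y" "\<And>y. y \<ge> 1 \<Longrightarrow> scaled_K0 y \<le> C"
    "\<And>y. y \<ge> 1 \<Longrightarrow> \<bar>V' y\<bar> \<le> C / y\<^sup>2"
    by (rule scaled_K0_bounds) (rule that)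
  define \<kappa> where "\<kappa> = csqrt \<i> * (- 2 * \<i> / of_real pi)"
  have \<kappa>: "norm \<kappa> > 0" by (simp add: \<kappa>_def del: csqrt_ii)
  have v_axis: "scaled_hankel (Complex 0 y) = \<kappa> * of_real (scaled_K0 y)" if "y > 0" for y
    using scaled_hankel_imaginary[OF that] by (simp add: \<kappa>_def Complex_eq)
  have v'_axis: "norm (v' (Complex 0 y)) = norm \<kappa> * \<bar>V' y\<bar>" if "y > 0" for y
  proof -
    have "((\<lambda>y. Complex 0 y) has_vector_derivative \<i>) (at y)"
      unfolding Complex_eq by (auto intro!: derivative_eq_intros)
    from field_vector_diff_chain_at[OF this, of scaled_hankel "v' (Complex 0 y)"] v(1)[of "Complex 0 y"] that
    have "((\<lambda>y. scaled_hankel (Complex 0 y)) has_vector_derivative \<i> * v' (Complex 0 y)) (at y)"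
      by (simp add: o_def)
    moreover have "((\<lambda>y. scaled_hankel (Complex 0 y)) has_vector_derivative \<kappa> * of_real (V' y)) (at y)"
    proof (rule has_vector_derivative_transform_within_open)
      show "((\<lambda>y. \<kappa> * of_real (scaled_K0 y)) has_vector_derivative \<kappa> * of_real (V' y)) (at y)"
        using has_vector_derivative_mult_right[OF has_vector_derivative_of_real, of scaled_K0 "V' y" "at y" \<kappa>]
          V(3)[OF that] by (simp add: has_real_derivative_iff_has_vector_derivative)
      show "open {0::real<..}" by simp
    qed (use that v_axis in auto)
    ultimately have "\<i> * v' (Complex 0 y) = \<kappa> * of_real (V' y)"
      by (rule vector_derivative_unique_at)
    then have "norm (\<i> * v' (Complex 0 y)) = norm (\<kappa> * of_real (V' y))" by simp
    then show ?thesis by (simp add: norm_mult)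
  qed
  define A where "A = norm \<kappa> * C"
  define a where "a = norm \<kappa> * c"
  have pos: "A > 0" "a > 0" using \<kappa> V by (auto simp: A_def a_def)
  \<comment> \<open>From this height on the errors collected along the line are at most \<open>a / 2\<close>, half of the lower bound on the axis.\<close>
  define y0 where "y0 = max 1 (6 * A / a)"
  have all: "norm (scaled_hankel z) \<ge> a / 2 \<and> norm (scaled_hankel z) \<le> 4 * A \<and> norm (v' z) \<le> 4 * A / Im z"
    if z: "Im z \<ge> y0" "Re z \<ge> 0" for z
  proof -
    define y where "y = Im z"
    have y: "y \<ge> 1" using z by (simp add: y_def y0_def)
    have zc: "z = Complex (Re z) y" by (simp add: y_def)
    define u0 where "u0 = norm (scaled_hankel (Complex 0 y))"
    define p0 where "p0 = norm (v' (Complex 0 y))"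
    have u0: "a \<le> u0" "u0 \<le> A"
      using y V(4)[OF y] V(5)[OF y] V(1) v_axis[of y]
      by (auto simp: u0_def norm_mult a_def A_def intro!: mult_left_mono)
    have "p0 \<le> norm \<kappa> * (C / y\<^sup>2)"
      using v'_axis[of y] y mult_left_mono[OF V(6)[OF y], of "norm \<kappa>"] unfolding p0_def by simp
    also have "\<dots> = A / y\<^sup>2" by (simp add: A_def)
    also have "\<dots> \<le> A / y"
      using pos y by (intro divide_left_mono) (auto simp: power2_eq_square)
    finally have p0: "p0 \<le> A / y" .
    have Ay: "A / y \<le> A" using pos y by (simp add: divide_le_eq)
    have up: "(u0 + p0) / y \<le> 2 * (A / y)"
      using divide_right_mono[of "u0 + p0" "2 * A" y] u0 p0 Ay y by simp
    have "6 * A / a \<le> y" using z by (simp add: y_def y0_def)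
    then have small: "3 * (A / y) \<le> a / 2" using pos y by (simp add: field_simps)
    note b = horizontal_line_bounds[OF v y z(2), folded zc, folded u0_def p0_def]
    have hi: "2 * (u0 + p0) \<le> 4 * A" using u0 p0 Ay by simp
    have "p0 + (u0 + p0) / y \<le> 4 * (A / y)" and lo: "a / 2 \<le> u0 - p0 - (u0 + p0) / y"
      using up p0 u0 small pos y divide_nonneg_nonneg[of A y] by linarith+
    then have der: "p0 + (u0 + p0) / y \<le> 4 * A / Im z" by (simp add: y_def)
    show ?thesis
      using order_trans[OF lo b(3)] order_trans[OF b(1) hi] order_trans[OF b(2) der] by blast
  qed
  show ?thesis
  proof (rule that[of "a / 2" "4 * A" y0 v'])
    show "1 \<le> y0" by (simp add: y0_def)
  qed (use all pos v in auto)
qed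

text \<open>
  Here the factor \<open>1 / csqrt z\<close> is kept, because its decay is part of the decay of the kernel.
\<close>

definition hankel_amplitude :: "complex \<Rightarrow> complex" where
  "hankel_amplitude z = exp (- \<i> * z) * hankel1_0 z"

lemma hankel_amplitude_bounds:
  obtains h' c C y0 where "0 < c" "0 < C" "1 \<le> y0"
    "\<And>z. Im z \<ge> y0 \<Longrightarrow> Re z \<ge> 0 \<Longrightarrow> (hankel_amplitude has_field_derivative h' z) (at z)"
    "\<And>z. Im z \<ge> y0 \<Longrightarrow> Re z \<ge> 0 \<Longrightarrow> norm (hankel_amplitude z) \<ge> c / sqrt (norm z)"
    "\<And>z. Im z \<ge> y0 \<Longrightarrow> Re z \<ge> 0 \<Longrightarrow> norm (hankel_amplitude z) \<le> C / sqrt (norm z)"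
    "\<And>z. Im z \<ge> y0 \<Longrightarrow> Re z \<ge> 0 \<Longrightarrow> norm (h' z) \<le> C / (sqrt (norm z) * Im z)"
proof -
  obtain v' c C y0 where b: "0 < c" "0 < C" "1 \<le> y0"
    "\<And>z. Im z > 0 \<Longrightarrow> (scaled_hankel has_field_derivative v' z) (at z)"
    "\<And>z. Im z \<ge> y0 \<Longrightarrow> Re z \<ge> 0 \<Longrightarrow> norm (scaled_hankel z) \<ge> c"
    "\<And>z. Im z \<ge> y0 \<Longrightarrow> Re z \<ge> 0 \<Longrightarrow> norm (scaled_hankel z) \<le> C"
    "\<And>z. Im z \<ge> y0 \<Longrightarrow> Re z \<ge> 0 \<Longrightarrow> norm (v' z) \<le> C / Im z"
    by (rule scaled_hankel_bounds) (rule that)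
  have amp: "hankel_amplitude z = scaled_hankel z / csqrt z" if "z \<noteq> 0" for z
    using that by (simp add: hankel_amplitude_def scaled_hankel_def)
  define h' where "h' z = (v' z - scaled_hankel z / (2 * z)) / csqrt z" for z
  show ?thesis
  proof (rule that[of c "2 * C" y0 h'])
    fix z assume z: "Im z \<ge> y0" "Re z \<ge> 0"
    have im: "Im z > 0" using z b(3) by simp
    then have nz: "z \<noteq> 0" by auto
    then have pos: "sqrt (norm z) > 0" by simp
    note s = has_field_derivative_csqrt_logarithmic[OF im]
    have "((\<lambda>z. scaled_hankel z / csqrt z) has_field_derivative h' z) (at z)"
      by (rule DERIV_cong[OF DERIV_divide[OF b(4)[OF im] s]])
         (use nz in \<open>simp_all add: h'_def field_simps power2_eq_square\<close>)
    then show "(hankel_amplitude has_field_derivative h' z) (at z)"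
      by (rule has_field_derivative_transform_within_open[of _ _ _ "- {0}"]) (use nz amp in auto)
    show "norm (hankel_amplitude z) \<ge> c / sqrt (norm z)"
      using b(5)[OF z] pos by (simp add: amp[OF nz] norm_divide divide_right_mono)
    have "norm (hankel_amplitude z) \<le> C / sqrt (norm z)"
      using b(6)[OF z] pos by (simp add: amp[OF nz] norm_divide divide_right_mono)
    also have "\<dots> \<le> 2 * C / sqrt (norm z)" using b(2) by (intro divide_right_mono) auto
    finally show "norm (hankel_amplitude z) \<le> 2 * C / sqrt (norm z)" .
    have "norm (v' z - scaled_hankel z / (2 * z)) \<le> norm (v' z) + norm (scaled_hankel z) / (2 * norm z)"
      using norm_triangle_ineq4[of "v' z" "scaled_hankel z / (2 * z)"] by (simp add: norm_divide norm_mult)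
    also have "norm (scaled_hankel z) / (2 * norm z) \<le> C / Im z"
      using b(2) b(6)[OF z] im abs_Im_le_cmod[of z] by (intro frac_le) auto
    finally have "norm (v' z - scaled_hankel z / (2 * z)) \<le> 2 * C / Im z"
      using b(7)[OF z] by simp
    then have "norm (h' z) \<le> (2 * C / Im z) / sqrt (norm z)"
      unfolding h'_def norm_divide norm_csqrt by (rule divide_right_mono) simp
    then show "norm (h' z) \<le> 2 * C / (sqrt (norm z) * Im z)" by (simp add: mult.commute)
  qed (use b in auto)
qed

section \<open>Integrals over a half-line\<close>

lemma half_line_neq_cbox:
  fixes a c d :: real
  shows "{a..} \<noteq> cbox c d" "{a<..} \<noteq> cbox c d"
proof -
  have "max a d + 1 \<in> {a..}" "max a d + 1 \<in> {a<..}" "max a d + 1 \<notin> cbox c d" by auto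
  then show "{a..} \<noteq> cbox c d" "{a<..} \<noteq> cbox c d" by blast+
qed

text \<open>
  Over a half-line the Henstock-Kurzweil integral is the improper one (Hake's theorem). Absolute
  convergence is not available when the exponential growth of a mode exactly balances the decay of
  the kernel.
\<close>

lemma has_integral_half_line:
  fixes f :: "real \<Rightarrow> 'a::banach"
  assumes f: "\<And>R. R \<ge> a \<Longrightarrow> (f has_integral F R) {a..R}" and F: "(F \<longlongrightarrow> L) at_top"
  shows "(f has_integral L) {a<..}"
proof -
  have "\<not> (\<exists>c d. {a..} = cbox c d)" using half_line_neq_cbox(1) by blast
  moreover have "\<exists>B>0. \<forall>c d. ball 0 B \<subseteq> cbox c d \<longrightarrow>
      (\<exists>z. ((\<lambda>x. if x \<in> {a..} then f x else 0) has_integral z) (cbox c d) \<and> norm (z - L) < e)"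
    if "e > 0" for e
  proof -
    have "\<forall>\<^sub>F R in at_top. norm (F R - L) < e"
      using tendstoD[OF F that] by (simp add: dist_norm)
    then obtain B where B: "\<And>R. R \<ge> B \<Longrightarrow> norm (F R - L) < e"
      unfolding eventually_at_top_linorder by blast
    define B' where "B' = 2 * max \<bar>a\<bar> \<bar>B\<bar> + 1"
    have "\<exists>z. ((\<lambda>x. if x \<in> {a..} then f x else 0) has_integral z) (cbox c d) \<and> norm (z - L) < e"
      if sub: "ball 0 B' \<subseteq> cbox c d" for c d
    proof (intro exI conjI)
      have "max \<bar>a\<bar> \<bar>B\<bar> \<in> ball 0 B'" "- max \<bar>a\<bar> \<bar>B\<bar> \<in> ball 0 B'" by (auto simp: B'_def)
      then have "max \<bar>a\<bar> \<bar>B\<bar> \<in> cbox c d" "- max \<bar>a\<bar> \<bar>B\<bar> \<in> cbox c d" using sub by blast+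
      then have cd: "c \<le> a" "a \<le> d" "B \<le> d"
        using max.cobounded1[of "\<bar>a\<bar>" "\<bar>B\<bar>"] max.cobounded2[of "\<bar>B\<bar>" "\<bar>a\<bar>"]
        unfolding cbox_interval atLeastAtMost_iff by linarith+
      have "((\<lambda>x. if x \<in> {a..d} then f x else 0) has_integral F d) {c..d}"
        using cd f[OF cd(2)] by (subst has_integral_restrict) auto
      then show "((\<lambda>x. if x \<in> {a..} then f x else 0) has_integral F d) (cbox c d)"
        unfolding cbox_interval by (rule has_integral_eq[rotated]) auto
      show "norm (F d - L) < e" by (rule B[OF cd(3)])
    qed
    moreover have "B' > 0" by (simp add: B'_def)
    ultimately show ?thesis by blast
  qed
  ultimately have "(f has_integral L) {a..}"
    by (subst has_integral_alt) simp
  moreover have "negligible ({a..} - {a<..})" "negligible ({a<..} - {a..})"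
    by (auto intro: negligible_subset[OF negligible_sing[of a]])
  ultimately show ?thesis
    using has_integral_spike_set_eq[of "{a..}" "{a<..}" f L] by (auto intro: negligible_subset)
qed

lemma integrable_half_line_Cauchy:
  fixes f :: "real \<Rightarrow> 'a::banach"
  assumes f: "f integrable_on {a<..}" and "e > 0"
  obtains B where "\<And>R R'. B \<le> R \<Longrightarrow> R \<le> R' \<Longrightarrow> norm (integral {R..R'} f) < e"
proof -
  define g where "g x = (if x \<in> {a<..} then f x else 0)" for x
  obtain L where L: "(f has_integral L) {a<..}" using f by blast
  have nb: "\<not> (\<exists>c d. {a<..} = cbox c d)" using half_line_neq_cbox(2) by blast
  have half: "e / 2 > 0" using \<open>e > 0\<close> by simp
  obtain B where B: "B > 0" "\<forall>c d. ball 0 B \<subseteq> cbox c d \<longrightarrow>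
      (\<exists>z. (g has_integral z) (cbox c d) \<and> norm (z - L) < e / 2)"
    unfolding g_def[abs_def] by (rule has_integral_altD[OF L nb half])
  have g: "g integrable_on {- B..R}" "norm (integral {- B..R} g - L) < e / 2" if "R \<ge> B" for R
  proof -
    have "ball 0 B \<subseteq> cbox (- B) R" using that by (auto simp: dist_real_def)
    with B(2) obtain z where "(g has_integral z) {- B..R}" "norm (z - L) < e / 2"
      unfolding cbox_interval by blast
    then show "g integrable_on {- B..R}" "norm (integral {- B..R} g - L) < e / 2"
      by (auto simp: integral_unique)
  qed
  show ?thesis
  proof (rule that[of "max B (a + 1)"])
    fix R R' assume R: "max B (a + 1) \<le> R" "R \<le> R'"
    have "integral {R..R'} f = integral {R..R'} g"
      using R by (intro integral_cong) (auto simp: g_def)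
    also have "\<dots> = integral {- B..R'} g - integral {- B..R} g"
      using Henstock_Kurzweil_Integration.integral_combine[of "- B" R R' g] g(1)[of R'] R B(1)
      by (simp add: eq_diff_eq add.commute)
    also have "\<dots> = (integral {- B..R'} g - L) - (integral {- B..R} g - L)" by simp
    also have "norm \<dots> < e"
      using norm_triangle_ineq4[of "integral {- B..R'} g - L" "integral {- B..R} g - L"]
        g(2)[of R] g(2)[of R'] R by simp
    finally show "norm (integral {R..R'} f) < e" .
  qed
qed

text \<open>
  If, arbitrarily far out, there are intervals on which \<open>f\<close> hardly changes but whose length times
  \<open>\<bar>f\<bar>\<close> stays bounded below, then the integrals over them violate the Cauchy criterion.
\<close>

lemma not_integrable_half_line_if_slowly_varying:
  fixes f :: "real \<Rightarrow> 'a::banach"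
  assumes f: "continuous_on {a..} f" and "e > 0"
    and *: "\<And>B. \<exists>R\<ge>B. \<exists>\<delta>\<ge>0. \<delta> * norm (f R) \<ge> e \<and>
              (\<forall>t\<in>{R..R + \<delta>}. norm (f t - f R) \<le> norm (f R) / 2)"
  shows "\<not> f integrable_on {a<..}"
proof
  assume int: "f integrable_on {a<..}"
  have half: "e / 2 > 0" using \<open>e > 0\<close> by simp
  obtain B where B: "\<And>R R'. B \<le> R \<Longrightarrow> R \<le> R' \<Longrightarrow> norm (integral {R..R'} f) < e / 2"
    by (rule integrable_half_line_Cauchy[OF int half]) (rule that)
  obtain R \<delta> where R: "R \<ge> max a B" "\<delta> \<ge> 0" "\<delta> * norm (f R) \<ge> e"
      "\<And>t. t \<in> {R..R + \<delta>} \<Longrightarrow> norm (f t - f R) \<le> norm (f R) / 2"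
    using *[of "max a B"] by blast
  have "f integrable_on {R..R + \<delta>}"
    using R by (intro integrable_continuous_interval continuous_on_subset[OF f]) auto
  then have "(f has_integral integral {R..R + \<delta>} f) (cbox R (R + \<delta>))"
    unfolding cbox_interval by (rule integrable_integral)
  moreover have "((\<lambda>t. f R) has_integral \<delta> *\<^sub>R f R) (cbox R (R + \<delta>))"
    using has_integral_const_real[of "f R" R "R + \<delta>"] R(2) by simp
  ultimately have "((\<lambda>t. f t - f R) has_integral (integral {R..R + \<delta>} f - \<delta> *\<^sub>R f R)) (cbox R (R + \<delta>))"
    by (rule has_integral_diff)
  then have "norm (integral {R..R + \<delta>} f - \<delta> *\<^sub>R f R) \<le> norm (f R) / 2 * measure lborel (cbox R (R + \<delta>))"
    by (rule has_integral_bound[rotated]) (use R(4) in auto)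
  then have "norm (integral {R..R + \<delta>} f - \<delta> *\<^sub>R f R) \<le> \<delta> * norm (f R) / 2"
    using R(2) by (simp add: mult.commute)
  moreover have "norm (\<delta> *\<^sub>R f R) = \<delta> * norm (f R)" using R(2) by simp
  ultimately have "norm (integral {R..R + \<delta>} f) \<ge> \<delta> * norm (f R) / 2"
    using norm_triangle_ineq2[of "\<delta> *\<^sub>R f R" "integral {R..R + \<delta>} f"]
    unfolding norm_minus_commute[of "\<delta> *\<^sub>R f R"] by linarith
  moreover have "norm (integral {R..R + \<delta>} f) < e / 2" using R by (intro B) auto
  ultimately show False using R(3) by simp
qed

text \<open>
  Integration by parts. \<open>W\<close>, the partial integral minus the boundary term, has derivative
  \<open>- exp (c t) g' t / c\<close>, which is dominated by the derivative of the bounded function \<open>\<phi>\<close>. The bound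
  depends on \<open>g\<close> only through \<open>C\<close>, and this gives uniformity in the layer thickness.
\<close>

lemma oscillatory_integral_converges:
  fixes g g' :: "real \<Rightarrow> complex"
  assumes g: "\<And>t. t \<ge> 0 \<Longrightarrow> (g has_vector_derivative g' t) (at t)"
    and g_le: "\<And>t. t \<ge> 0 \<Longrightarrow> norm (g t) \<le> C / sqrt (1 + t)"
    and g'_le: "\<And>t. t \<ge> 0 \<Longrightarrow> norm (g' t) \<le> C / sqrt (1 + t) ^ 3"
    and c: "Re c \<le> 0" "c \<noteq> 0"
  shows "(\<lambda>t. exp (c * of_real t) * g t) integrable_on {0<..}"
    and "norm (integral {0<..} (\<lambda>t. exp (c * of_real t) * g t)) \<le> 3 * C / norm c"
proof -
  define f where "f t = exp (c * of_real t) * g t" for t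
  have e: "((\<lambda>t. exp (c * of_real t)) has_vector_derivative c * exp (c * of_real t)) (at t)" for t :: real
    by (rule has_vector_derivative_real_field[where f = "\<lambda>z. exp (c * z)"])
       (auto intro!: derivative_eq_intros)
  have e1: "norm (exp (c * of_real t)) \<le> 1" if "t \<ge> 0" for t :: real
    using c that by (simp add: mult_nonpos_nonneg)
  have C: "C \<ge> 0" using order_trans[OF norm_ge_zero g_le[of 0]] by simp
  have df: "(f has_vector_derivative c * exp (c * of_real t) * g t + exp (c * of_real t) * g' t) (at t)"
    if "t \<ge> 0" for t
    unfolding f_def[abs_def] using has_vector_derivative_mult[OF e g[OF that]] by (simp add: algebra_simps)
  have cont: "continuous_on {0..R} f" for R
    by (intro continuous_at_imp_continuous_on ballI has_vector_derivative_continuous[OF df]) auto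
  define F where "F R = integral {0..R} f" for R
  have F: "(f has_integral F R) {0..R}" for R
    unfolding F_def by (intro integrable_integral integrable_continuous_interval cont)
  have dF: "(F has_vector_derivative f t) (at t)" if "t > 0" for t
    using integral_has_vector_derivative[OF cont[of "t + 1"], of t] that
    unfolding F_def[abs_def] by (simp add: at_within_Icc_at)
  define W where "W t = F t - f t / c" for t
  have dW: "(W has_vector_derivative - (exp (c * of_real t) * g' t / c)) (at t)" if "t > 0" for t
  proof -
    have "((\<lambda>t. f t * inverse c) has_vector_derivative
        (c * exp (c * of_real t) * g t + exp (c * of_real t) * g' t) * inverse c) (at t)"
      using that by (intro has_vector_derivative_mult_left df) auto
    from has_vector_derivative_diff[OF dF[OF that] this] show ?thesis
      using c unfolding W_def[abs_def] by (simp add: f_def field_simps)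
  qed
  have cW: "continuous_on {0..R} W" for R
  proof -
    have "continuous_on {0..R} F"
      unfolding F_def[abs_def] by (intro indefinite_integral_continuous_1 integrable_continuous_interval cont)
    then show ?thesis unfolding W_def[abs_def] by (intro continuous_intros cont) (use c in auto)
  qed
  define K where "K = 2 * C / norm c"
  define \<phi> where "\<phi> t = - K / sqrt (1 + t)" for t
  have d\<phi>: "(\<phi> has_vector_derivative K / 2 / sqrt (1 + t) ^ 3) (at t)" if "t \<ge> 0" for t
    unfolding has_real_derivative_iff_has_vector_derivative[symmetric] \<phi>_def[abs_def]
    using that by (auto intro!: derivative_eq_intros simp: field_simps power3_eq_cube)
  have W'_le: "norm (- (exp (c * of_real t) * g' t / c)) \<le> K / 2 / sqrt (1 + t) ^ 3" if "t > 0" for t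
  proof -
    have "norm (exp (c * of_real t)) * norm (g' t) \<le> 1 * (C / sqrt (1 + t) ^ 3)"
      using that by (intro mult_mono e1 g'_le) auto
    from divide_right_mono[OF this norm_ge_zero[of c]]
    show ?thesis by (simp only: norm_minus_cancel norm_divide norm_mult) (simp add: K_def field_simps)
  qed
  have W: "norm (W R' - W R) \<le> \<phi> R' - \<phi> R" if "0 \<le> R" "R \<le> R'" for R R'
  proof (cases "R = R'")
    case False
    show ?thesis
    proof (rule differentiable_bound_general[where f' = "\<lambda>t. - (exp (c * of_real t) * g' t / c)"
          and \<phi>' = "\<lambda>t. K / 2 / sqrt (1 + t) ^ 3"])
      show "R < R'" using that False by simp
      show "continuous_on {R..R'} W" using cW[of R'] by (rule continuous_on_subset) (use that in auto)
      show "continuous_on {R..R'} \<phi>"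
        by (intro continuous_at_imp_continuous_on ballI has_vector_derivative_continuous[OF d\<phi>])
           (use that in auto)
      fix t assume t: "R < t" "t < R'"
      then have t0: "t > 0" using that by simp
      show "(W has_vector_derivative - (exp (c * of_real t) * g' t / c)) (at t)" by (rule dW[OF t0])
      show "(\<phi> has_vector_derivative K / 2 / sqrt (1 + t) ^ 3) (at t)" using t0 by (intro d\<phi>) simp
      show "norm (- (exp (c * of_real t) * g' t / c)) \<le> K / 2 / sqrt (1 + t) ^ 3"
        by (rule W'_le[OF t0])
    qed
  next
    case True
    then show ?thesis by (simp only: diff_self norm_zero order_refl)
  qed
  have \<phi>_neg: "\<phi> t \<le> 0" if "t \<ge> 0" for t using that C by (simp add: \<phi>_def K_def)
  have s_lim: "((\<lambda>t. 1 / sqrt (1 + t)) \<longlongrightarrow> 0) at_top" by real_asymp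
  have \<phi>_lim: "(\<phi> \<longlongrightarrow> 0) at_top"
    using tendsto_mult_left[OF s_lim, of "- K"] by (simp add: \<phi>_def[abs_def])
  have Wn: "norm (W R' - W R) \<le> - \<phi> R" if "0 \<le> R" "R \<le> R'" for R R'
    using W[OF that] \<phi>_neg[of R'] that by simp
  have "Cauchy (\<lambda>n. W (real n))"
  proof (rule metric_CauchyI)
    fix r :: real assume "r > 0"
    have "\<forall>\<^sub>F t in at_top. - \<phi> t < r / 2"
      using tendstoD[OF \<phi>_lim, of "r / 2"] \<open>r > 0\<close> by (auto simp: dist_norm elim!: eventually_mono)
    then obtain N where N: "\<And>t. t \<ge> N \<Longrightarrow> - \<phi> t < r / 2"
      unfolding eventually_at_top_linorder by blast
    define M where "M = nat \<lceil>max N 0\<rceil>"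
    have M: "real M \<ge> N" unfolding M_def by linarith
    have "dist (W (real m)) (W (real M)) < r / 2" if "m \<ge> M" for m
      using Wn[of "real M" "real m"] N[OF M] that by (simp add: dist_norm)
    then show "\<exists>M. \<forall>m\<ge>M. \<forall>n\<ge>M. dist (W (real m)) (W (real n)) < r"
      by (metis dist_triangle_half_l)
  qed
  then obtain L where L: "(\<lambda>n. W (real n)) \<longlonglongrightarrow> L"
    using Cauchy_convergent convergent_def by blast
  have WL: "norm (W R - L) \<le> - \<phi> R" if "R \<ge> 0" for R
  proof (rule tendsto_upperbound)
    show "(\<lambda>n. norm (W R - W (real n))) \<longlonglongrightarrow> norm (W R - L)" by (intro tendsto_intros L)
    have "\<forall>\<^sub>F n in sequentially. R \<le> real n"
      using filterlim_real_sequentially by (simp add: filterlim_at_top)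
    then show "\<forall>\<^sub>F n in sequentially. norm (W R - W (real n)) \<le> - \<phi> R"
      by eventually_elim (subst norm_minus_commute, rule Wn[OF that])
  qed simp
  have "(W \<longlongrightarrow> L) at_top"
  proof (rule LIM_zero_cancel, rule Lim_null_comparison)
    show "\<forall>\<^sub>F R in at_top. norm (W R - L) \<le> - \<phi> R"
      using eventually_ge_at_top[of 0] by eventually_elim (rule WL)
    show "((\<lambda>R. - \<phi> R) \<longlongrightarrow> 0) at_top" using tendsto_minus[OF \<phi>_lim] by simp
  qed
  moreover have "((\<lambda>R. f R / c) \<longlongrightarrow> 0) at_top"
  proof (rule Lim_null_comparison)
    show "\<forall>\<^sub>F R in at_top. norm (f R / c) \<le> C / sqrt (1 + R) / norm c"
      using eventually_ge_at_top[of 0]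
    proof eventually_elim
      case (elim R)
      have "norm (exp (c * of_real R)) * norm (g R) \<le> 1 * (C / sqrt (1 + R))"
        using elim by (intro mult_mono e1 g_le) auto
      from divide_right_mono[OF this norm_ge_zero[of c]]
      show ?case by (simp only: f_def norm_divide norm_mult mult_1)
    qed
    show "((\<lambda>R. C / sqrt (1 + R) / norm c) \<longlongrightarrow> 0) at_top"
      using tendsto_mult_left[OF s_lim, of "C / norm c"] by (simp add: mult.commute)
  qed
  ultimately have "((\<lambda>R. W R + f R / c) \<longlongrightarrow> L + 0) at_top" by (rule tendsto_add)
  then have "(F \<longlongrightarrow> L) at_top" by (simp add: W_def)
  then have "(f has_integral L) {0<..}" by (rule has_integral_half_line[where F = F, rotated]) (rule F)
  moreover have "norm L \<le> 3 * C / norm c"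
  proof -
    have "norm (W 0) \<le> C / norm c"
      using g_le[of 0] by (simp add: W_def F_def f_def norm_divide divide_right_mono)
    moreover have "norm L \<le> norm (W 0) + norm (W 0 - L)"
      using norm_triangle_ineq4[of "W 0" "W 0 - L"] by simp
    ultimately show ?thesis using WL[of 0] by (simp add: \<phi>_def K_def)
  qed
  ultimately show "(\<lambda>t. exp (c * of_real t) * g t) integrable_on {0<..}"
    and "norm (integral {0<..} (\<lambda>t. exp (c * of_real t) * g t)) \<le> 3 * C / norm c"
    unfolding f_def[abs_def] by (auto simp: integral_unique)
qed

lemma has_integral_half_line_shift:
  fixes f :: "real \<Rightarrow> 'a::banach"
  assumes "(f has_integral I) {b<..}"
  shows "((\<lambda>x. f (x - a)) has_integral I) {b + a<..}"
proof -
  have nb: "\<not> (\<exists>c d. {b<..} = cbox c d)" for b :: real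
    using half_line_neq_cbox(2) by blast
  have "\<exists>B>0. \<forall>c d. ball 0 B \<subseteq> cbox c d \<longrightarrow>
      (\<exists>z. ((\<lambda>x. if x \<in> {b + a<..} then f (x - a) else 0) has_integral z) (cbox c d) \<and> norm (z - I) < e)"
    if e: "e > 0" for e
  proof -
    obtain B where B: "B > 0" "\<forall>c d. ball 0 B \<subseteq> cbox c d \<longrightarrow>
        (\<exists>z. ((\<lambda>x. if x \<in> {b<..} then f x else 0) has_integral z) (cbox c d) \<and> norm (z - I) < e)"
      by (rule has_integral_altD[OF assms nb e])
    have "\<exists>z. ((\<lambda>x. if x \<in> {b + a<..} then f (x - a) else 0) has_integral z) (cbox c d) \<and> norm (z - I) < e"
      if sub: "ball 0 (B + \<bar>a\<bar>) \<subseteq> cbox c d" for c d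
    proof -
      have "ball 0 B \<subseteq> cbox (c - a) (d - a)"
      proof
        fix x :: real assume "x \<in> ball 0 B"
        then have "x + a \<in> ball 0 (B + \<bar>a\<bar>)" by (auto simp: dist_real_def)
        with sub have "x + a \<in> cbox c d" by blast
        then show "x \<in> cbox (c - a) (d - a)" by simp
      qed
      with B(2) obtain z where z: "((\<lambda>x. if x \<in> {b<..} then f x else 0) has_integral z) (cbox (c - a) (d - a))"
        "norm (z - I) < e" by blast
      have "((\<lambda>x. if x - a \<in> {b<..} then f (x - a) else 0) has_integral z) {c..d}"
        using has_integral_shift_real_ivl[of _ z "c - a" "d - a" "- a"] z(1) by fastforce
      moreover have "x - a \<in> {b<..} \<longleftrightarrow> x \<in> {b + a<..}" for x by auto
      ultimately show ?thesis using z(2) by auto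
    qed
    then show ?thesis using B(1) by (intro exI[of _ "B + \<bar>a\<bar>"]) (auto intro: add_pos_nonneg)
  qed
  then show ?thesis using nb[of "b + a"] by (subst has_integral_alt) simp
qed

text \<open>
  The complementary case. If \<open>Re c > 0\<close>, the integrand hardly changes on intervals of a small fixed
  length and grows exponentially; if \<open>c = 0\<close>, it hardly changes on intervals of length \<open>sqrt R\<close> at \<open>R\<close>,
  where it is of size \<open>1 / sqrt R\<close>.
\<close>

lemma oscillatory_integral_diverges:
  fixes g g' :: "real \<Rightarrow> complex"
  assumes g: "\<And>t. t \<ge> 0 \<Longrightarrow> (g has_vector_derivative g' t) (at t)"
    and g_ge: "\<And>t. t \<ge> 0 \<Longrightarrow> norm (g t) \<ge> b / sqrt (1 + t)" and "b > 0"
    and g'_le: "\<And>t. t \<ge> 0 \<Longrightarrow> norm (g' t) \<le> C / sqrt (1 + t) ^ 3"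
    and c: "c = 0 \<or> Re c > 0"
  shows "\<not> (\<lambda>t. exp (c * of_real t) * g t) integrable_on {0<..}"
proof -
  define f where "f t = exp (c * of_real t) * g t" for t
  have C: "C \<ge> 0" using order_trans[OF norm_ge_zero g'_le[of 0]] by simp
  have "isCont (\<lambda>t. exp (c * of_real t)) 0" by (intro continuous_intros)
  then have "\<forall>\<^sub>F t in at 0. dist (exp (c * of_real t)) 1 < 1 / 4"
    unfolding isCont_def by (intro tendstoD) auto
  then obtain d where d: "d > 0" "\<And>t::real. t \<noteq> 0 \<Longrightarrow> \<bar>t\<bar> < d \<Longrightarrow> norm (exp (c * of_real t) - 1) < 1 / 4"
    unfolding eventually_at by (auto simp: dist_norm)
  define d0 where "d0 = min 1 (d / 2)"
  have d0: "d0 > 0" "d0 \<le> 1" using d by (auto simp: d0_def)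
  define \<delta> where "\<delta> R = (if c = 0 then sqrt (1 + R) else d0)" for R
  have \<delta>: "0 < \<delta> R" "\<delta> R \<le> sqrt (1 + R)" if "R \<ge> 0" for R
    using that d0 by (auto simp: \<delta>_def intro: order_trans[of d0 1])
  have near: "norm (exp (c * of_real t) - 1) \<le> 1 / 4" if "0 \<le> t" "t \<le> \<delta> R" for t R
    using d(2)[of t] d(1) that by (cases "t = 0") (auto simp: \<delta>_def d0_def split: if_splits)
  have g_slow: "norm (g (R + t) - g R) \<le> t * (C / sqrt (1 + R) ^ 3)" if "R \<ge> 0" "t \<ge> 0" for R t
  proof (cases "t = 0")
    case False
    have "norm (g (R + t) - g R) \<le> C / sqrt (1 + R) ^ 3 * (R + t) - C / sqrt (1 + R) ^ 3 * R"
    proof (rule differentiable_bound_general)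
      show "continuous_on {R..R + t} g"
        by (intro continuous_at_imp_continuous_on ballI has_vector_derivative_continuous[OF g])
           (use that in auto)
      fix r assume r: "R < r" "r < R + t"
      show "(g has_vector_derivative g' r) (at r)" using r that by (intro g) auto
      show "((\<lambda>r. C / sqrt (1 + R) ^ 3 * r) has_vector_derivative C / sqrt (1 + R) ^ 3) (at r)"
        unfolding has_real_derivative_iff_has_vector_derivative[symmetric]
        by (auto intro!: derivative_eq_intros)
      have "norm (g' r) \<le> C / sqrt (1 + r) ^ 3" using r that by (intro g'_le) auto
      also have "\<dots> \<le> C / sqrt (1 + R) ^ 3"
        using r that C by (intro divide_left_mono power_mono mult_pos_pos) auto
      finally show "norm (g' r) \<le> C / sqrt (1 + R) ^ 3" .
    qed (use False that in \<open>auto intro!: continuous_intros\<close>)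
    then show ?thesis by (simp add: algebra_simps add_divide_distrib)
  qed simp
  have "\<forall>\<^sub>F R in at_top. R \<ge> 0 \<and> sqrt (1 + R) \<ge> 8 * C / b \<and> \<delta> R * norm (f R) \<ge> b * d0"
  proof -
    have "filterlim (\<lambda>R::real. sqrt (1 + R)) at_top at_top" by real_asymp
    then have "\<forall>\<^sub>F R in at_top. sqrt (1 + R) \<ge> 8 * C / b" by (simp add: filterlim_at_top)
    moreover have "\<forall>\<^sub>F R in at_top. exp (Re c * R) * \<delta> R / sqrt (1 + R) \<ge> d0"
    proof (cases "c = 0")
      case True
      show ?thesis using eventually_ge_at_top[of 0]
        by eventually_elim (use True d0 in \<open>simp add: \<delta>_def\<close>)
    next
      case False
      have exp_wins: "\<forall>\<^sub>F R in at_top. exp (r * R) / sqrt (1 + R) \<ge> 1" if "r > 0" for r :: real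
        using that by real_asymp
      have "\<forall>\<^sub>F R in at_top. exp (Re c * R) / sqrt (1 + R) \<ge> 1"
        using False c by (intro exp_wins) simp
      then show ?thesis
      proof eventually_elim
        case (elim R)
        from mult_left_mono[OF this, of d0] show ?case using False d0 by (simp add: \<delta>_def mult_ac)
      qed
    qed
    ultimately show ?thesis using eventually_ge_at_top[of 0]
    proof eventually_elim
      case (elim R)
      have "b * d0 \<le> b * (exp (Re c * R) * \<delta> R / sqrt (1 + R))"
        using elim \<open>b > 0\<close> by (intro mult_left_mono) auto
      also have "\<dots> = \<delta> R * (exp (Re c * R) * (b / sqrt (1 + R)))" by (simp add: mult_ac)
      also have "\<dots> \<le> \<delta> R * (exp (Re c * R) * norm (g R))"
        using \<delta>[OF elim(3)] elim by (intro mult_left_mono g_ge) auto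
      also have "\<dots> = \<delta> R * norm (f R)" by (simp add: f_def norm_mult)
      finally show ?case using elim by simp
    qed
  qed
  then obtain R0 where R0: "\<And>R. R \<ge> R0 \<Longrightarrow>
      R \<ge> 0 \<and> sqrt (1 + R) \<ge> 8 * C / b \<and> \<delta> R * norm (f R) \<ge> b * d0"
    unfolding eventually_at_top_linorder by blast
  have "\<not> f integrable_on {0<..}"
  proof (rule not_integrable_half_line_if_slowly_varying)
    show "continuous_on {0..} f"
      unfolding f_def[abs_def]
      by (intro continuous_intros continuous_at_imp_continuous_on ballI has_vector_derivative_continuous[OF g]) auto
    show "b * d0 > 0" using \<open>b > 0\<close> d0 by simp
    fix B
    define R where "R = max B R0"
    have R: "R \<ge> 0" "sqrt (1 + R) \<ge> 8 * C / b" "\<delta> R * norm (f R) \<ge> b * d0"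
      using R0[of R] by (auto simp: R_def)
    have "norm (f t - f R) \<le> norm (f R) / 2" if t: "t \<in> {R..R + \<delta> R}" for t
    proof -
      define s where "s = t - R"
      have s: "0 \<le> s" "s \<le> \<delta> R" "t = R + s" using t by (auto simp: s_def)
      have E: "norm (exp (c * of_real s)) \<le> 2"
        using near[OF s(1,2)] norm_triangle_sub[of "exp (c * of_real s)" 1] by simp
      have "norm (g t - g R) \<le> s * (C / sqrt (1 + R) ^ 3)" using g_slow[OF R(1) s(1)] s(3) by simp
      also have "\<dots> \<le> sqrt (1 + R) * (C / sqrt (1 + R) ^ 3)"
        using s \<delta>[OF R(1)] C R(1) by (intro mult_right_mono) auto
      also have "\<dots> = C / sqrt (1 + R) / sqrt (1 + R)"
        using R(1) by (simp add: power3_eq_cube)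
      also have "\<dots> \<le> b / 8 / sqrt (1 + R)"
      proof (rule divide_right_mono)
        have "sqrt (1 + R) > 0" using R(1) by simp
        then show "C / sqrt (1 + R) \<le> b / 8"
          using R(2) \<open>b > 0\<close> by (simp add: field_simps)
      qed (use R(1) in simp)
      also have "\<dots> \<le> norm (g R) / 8" using g_ge[OF R(1)] by simp
      finally have G: "norm (g t - g R) \<le> norm (g R) / 8" .
      have "f t - f R = exp (c * of_real R) *
          (exp (c * of_real s) * (g t - g R) + (exp (c * of_real s) - 1) * g R)"
        by (simp add: f_def s(3) algebra_simps exp_add)
      also have "norm \<dots> \<le> norm (exp (c * of_real R)) * (2 * (norm (g R) / 8) + 1 / 4 * norm (g R))"
      proof -
        have "norm (exp (c * of_real s) * (g t - g R)) \<le> 2 * (norm (g R) / 8)"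
          unfolding norm_mult by (rule mult_mono[OF E G]) auto
        moreover have "norm ((exp (c * of_real s) - 1) * g R) \<le> 1 / 4 * norm (g R)"
          unfolding norm_mult by (rule mult_right_mono[OF near[OF s(1,2)]]) simp
        ultimately show ?thesis
          unfolding norm_mult[of "exp (c * of_real R)"]
          by (intro mult_left_mono order_trans[OF norm_triangle_ineq] add_mono) auto
      qed
      also have "\<dots> = norm (f R) / 2" by (simp add: f_def norm_mult)
      finally show ?thesis .
    qed
    then show "\<exists>R\<ge>B. \<exists>\<delta>\<ge>0. \<delta> * norm (f R) \<ge> b * d0 \<and>
        (\<forall>t\<in>{R..R + \<delta>}. norm (f t - f R) \<le> norm (f R) / 2)"
      using R \<delta>[OF R(1)] by (intro exI[of _ R] conjI exI[of _ "\<delta> R"]) (auto simp: R_def)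
  qed
  then show ?thesis by (simp add: f_def[abs_def])
qed

section \<open>The kernel on the stretched half-line\<close>

text \<open>
  \<open>(\<rho> - Z) (\<rho> + Z) = d\<^sup>2\<close>, and \<open>\<bar>\<rho> + Z\<bar> \<ge> \<bar>Z\<bar>\<close> because both numbers lie in the first quadrant.
\<close>

lemma csqrt_sum_squares_close:
  fixes Z :: complex and d :: real
  assumes Z: "Re Z > 0" "Im Z > 0"
  defines "\<rho> \<equiv> csqrt ((of_real d)\<^sup>2 + Z\<^sup>2)"
  shows "(of_real d)\<^sup>2 + Z\<^sup>2 \<notin> \<real>\<^sub>\<le>\<^sub>0" "Re \<rho> \<ge> 0" "norm (\<rho> - Z) \<le> d\<^sup>2 / norm Z"
proof -
  have im: "Im ((of_real d)\<^sup>2 + Z\<^sup>2) = 2 * Re Z * Im Z"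
    by (simp add: power2_eq_square)
  then have im_pos: "Im ((of_real d)\<^sup>2 + Z\<^sup>2) > 0" using Z by simp
  then show "(of_real d)\<^sup>2 + Z\<^sup>2 \<notin> \<real>\<^sub>\<le>\<^sub>0" by (auto simp: complex_nonpos_Reals_iff)
  show re: "Re \<rho> \<ge> 0" unfolding \<rho>_def by (rule Re_csqrt)
  have sq: "\<rho>\<^sup>2 = (of_real d)\<^sup>2 + Z\<^sup>2" by (simp add: \<rho>_def)
  have "Im (\<rho>\<^sup>2) > 0" unfolding sq by (rule im_pos)
  then have "Re \<rho> * Im \<rho> > 0" by (simp add: power2_eq_square mult.commute)
  with re have "Im \<rho> > 0" by (simp add: zero_less_mult_iff)
  have "norm Z \<le> norm (\<rho> + Z)"
    using Z re \<open>Im \<rho> > 0\<close> unfolding cmod_def by (intro real_sqrt_le_mono add_mono power_mono) auto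
  then have "norm (\<rho> - Z) * norm Z \<le> norm (\<rho> - Z) * norm (\<rho> + Z)" by (intro mult_left_mono) auto
  also have "\<dots> = norm ((of_real d :: complex)\<^sup>2)"
    unfolding norm_mult[symmetric] using sq by (simp add: algebra_simps power2_eq_square)
  also have "\<dots> = d\<^sup>2" by (simp add: norm_power)
  finally show "norm (\<rho> - Z) \<le> d\<^sup>2 / norm Z"
    using Z by (subst pos_le_divide_eq) auto
qed

text \<open>
  What remains of the Hankel function \<open>H\<^sub>0(k \<rho>)\<close> after division by \<open>exp (\<i> k Z)\<close>, where
  \<open>Z = Z0 + (1 + \<i> S) t\<close> is the stretched vertical distance, which is affine beyond the layer, and \<open>d\<close>
  the horizontal distance.
\<close>

definition pml_amplitude :: "real \<Rightarrow> real \<Rightarrow> real \<Rightarrow> complex \<Rightarrow> real \<Rightarrow> complex" where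
  "pml_amplitude k S d Z0 t =
     (let Z = Z0 + Complex 1 S * of_real t; \<rho> = csqrt ((of_real d)\<^sup>2 + Z\<^sup>2)
      in hankel_amplitude (of_real k * \<rho>) * exp (\<i> * of_real k * (\<rho> - Z)))"

text \<open>
  As \<open>\<rho> - Z\<close> tends to \<open>0\<close>, the amplitude inherits decay and slow variation from the Hankel
  amplitude. The cone condition on \<open>Z0\<close>, which \<open>m \<le> S\<close> propagates along the half-line, makes
  \<open>Im Z\<close> comparable to \<open>\<bar>Z\<bar>\<close>, so that one power of \<open>\<bar>Z\<bar>\<close> is gained by differentiating. \<open>C\<close> serves all
  \<open>Z0\<close> far enough out, whereas the lower bound \<open>b\<close> may depend on \<open>Z0\<close>.
\<close>

lemma pml_amplitude_bounds:
  assumes k: "k > 0" and m: "0 < m" "m \<le> S"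
  obtains C R0 where "1 \<le> R0"
    "\<And>Z0. Re Z0 \<ge> R0 \<Longrightarrow> Im Z0 \<ge> m * Re Z0 \<Longrightarrow> \<exists>g' b. b > 0 \<and> (\<forall>t\<ge>0.
       (pml_amplitude k S d Z0 has_vector_derivative g' t) (at t) \<and>
       norm (pml_amplitude k S d Z0 t) \<le> C / sqrt (1 + t) \<and>
       norm (g' t) \<le> C / sqrt (1 + t) ^ 3 \<and>
       norm (pml_amplitude k S d Z0 t) \<ge> b / sqrt (1 + t))"
proof -
  obtain h' c C0 y0 where h: "0 < c" "0 < C0" "1 \<le> y0"
    "\<And>z. Im z \<ge> y0 \<Longrightarrow> Re z \<ge> 0 \<Longrightarrow> (hankel_amplitude has_field_derivative h' z) (at z)"
    "\<And>z. Im z \<ge> y0 \<Longrightarrow> Re z \<ge> 0 \<Longrightarrow> norm (hankel_amplitude z) \<ge> c / sqrt (norm z)"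
    "\<And>z. Im z \<ge> y0 \<Longrightarrow> Re z \<ge> 0 \<Longrightarrow> norm (hankel_amplitude z) \<le> C0 / sqrt (norm z)"
    "\<And>z. Im z \<ge> y0 \<Longrightarrow> Re z \<ge> 0 \<Longrightarrow> norm (h' z) \<le> C0 / (sqrt (norm z) * Im z)"
    by (rule hankel_amplitude_bounds) (rule that)
  \<comment> \<open>The entries give in turn \<open>\<bar>Z\<bar> \<ge> 1 + t\<close>, \<open>\<bar>\<rho> - Z\<bar> \<le> 1 / 2\<close>, \<open>Im Z \<ge> 1\<close> (hence \<open>Im \<rho> \<ge> Im Z / 2\<close>), and \<open>Im (k \<rho>) \<ge> y0\<close>.\<close>
  define R0 where "R0 = Max {1, 2 * d\<^sup>2, 1 / m, 2 * y0 / (k * m)}"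
  have R0: "1 \<le> R0" "2 * d\<^sup>2 \<le> R0" "1 / m \<le> R0" "2 * y0 / (k * m) \<le> R0"
    by (auto simp: R0_def)
  define \<mu> where "\<mu> = m / (1 + m)"
  have \<mu>: "\<mu> > 0" using m by (simp add: \<mu>_def)
  define a where "a = norm (Complex 1 S)"
  have a: "a > 0" unfolding a_def zero_less_norm_iff by (simp add: complex_eq_iff)
  define D where "D = C0 / sqrt (k / 2)"
  have D: "D > 0" using h k by (simp add: D_def)
  define C1 where "C1 = D * exp k"
  define C2 where "C2 = C1 * a * (4 / \<mu> + k)"
  define C where "C = max C1 C2"
  have C1: "C1 > 0" using D by (simp add: C1_def)
  have C2: "C2 > 0" using C1 a \<mu> k by (simp add: C2_def add_pos_pos)
  show ?thesis
  proof (rule that[of R0 C])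
    show "1 \<le> R0" by (rule R0)
    fix Z0 assume Z0: "Re Z0 \<ge> R0" "Im Z0 \<ge> m * Re Z0"
    define Z where "Z t = Z0 + Complex 1 S * of_real t" for t
    define \<rho> where "\<rho> t = csqrt ((of_real d)\<^sup>2 + (Z t)\<^sup>2)" for t
    define g where "g = pml_amplitude k S d Z0"
    have g: "g t = hankel_amplitude (of_real k * \<rho> t) * exp (\<i> * of_real k * (\<rho> t - Z t))" for t
      by (simp add: g_def pml_amplitude_def Let_def Z_def \<rho>_def)
    define \<rho>' where "\<rho>' t = Z t * Complex 1 S / \<rho> t" for t
    define g' where "g' t = (of_real k * \<rho>' t * h' (of_real k * \<rho> t)
        + hankel_amplitude (of_real k * \<rho> t) * (\<i> * of_real k * (\<rho>' t - Complex 1 S)))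
        * exp (\<i> * of_real k * (\<rho> t - Z t))" for t
    define b where "b = c * exp (- k) / sqrt (2 * k * (norm Z0 + a))"
    have "norm Z0 > 0" using Z0 R0 by auto
    then have Z0a: "norm Z0 + a > 0" using a by (rule add_pos_pos)
    have b: "b > 0" using h(1) k Z0a unfolding b_def
      by (intro divide_pos_pos mult_pos_pos real_sqrt_gt_zero) auto
    have main: "(g has_vector_derivative g' t) (at t) \<and> norm (g t) \<le> C1 / sqrt (1 + t) \<and>
       norm (g' t) \<le> C2 / sqrt (1 + t) ^ 3 \<and> norm (g t) \<ge> b / sqrt (1 + t)"
      if t: "t \<ge> 0" for t
    proof -
      define N where "N = norm (Z t)"
      have reZ: "Re (Z t) = Re Z0 + t" and imZ: "Im (Z t) = Im Z0 + S * t"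
        by (simp_all add: Z_def)
      have im_ge: "Im (Z t) \<ge> m * Re (Z t)"
        using Z0 m t mult_right_mono[of m S t] by (simp add: reZ imZ distrib_left)
      have re_ge: "Re (Z t) \<ge> R0" "Re (Z t) \<ge> 1 + t" using Z0 R0 t by (simp_all add: reZ)
      have "m * R0 \<le> m * Re (Z t)" using re_ge m by simp
      then have imR: "Im (Z t) \<ge> m * R0" using im_ge by simp
      have "1 \<le> m * R0" using R0(3) m by (simp add: field_simps)
      then have im1: "Im (Z t) \<ge> 1" using imR by simp
      have pos: "Re (Z t) > 0" "Im (Z t) > 0" using re_ge R0 im1 by simp_all
      note cl = csqrt_sum_squares_close[OF pos, of d, folded \<rho>_def]
      have N_ge: "N \<ge> 1 + t" "N \<ge> R0"
        using re_ge complex_Re_le_cmod[of "Z t"] by (simp_all add: N_def)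
      have N0: "N > 0" using N_ge R0 by simp
      have "2 * d\<^sup>2 / N \<le> 1" using N_ge R0 N0 by (simp add: divide_le_eq)
      then have close: "norm (\<rho> t - Z t) \<le> 1 / 2" using cl(3) by (simp add: N_def)
      have \<rho>_hi: "norm (\<rho> t) \<le> 2 * N" and \<rho>_lo: "N / 2 \<le> norm (\<rho> t)"
        using norm_triangle_ineq2[of "\<rho> t" "Z t"] norm_triangle_ineq2[of "Z t" "\<rho> t"] close N_ge R0
        by (simp_all add: N_def norm_minus_commute)
      have \<rho>0: "norm (\<rho> t) > 0" using \<rho>_lo N0 by linarith
      then have \<rho>n0: "\<rho> t \<noteq> 0" by auto
      have im\<rho>: "Im (\<rho> t) \<ge> Im (Z t) / 2"
        using abs_Im_le_cmod[of "\<rho> t - Z t"] close im1 by simp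
      define z where "z = of_real k * \<rho> t"
      have "y0 \<le> k * (m * R0) / 2" using R0(4) k m by (simp add: field_simps)
      also have "\<dots> \<le> k * (Im (Z t) / 2)" using imR k by simp
      also have "\<dots> \<le> Im z" using im\<rho> k by (simp add: z_def)
      finally have z: "Im z \<ge> y0" "Re z \<ge> 0" using cl(2) k by (simp_all add: z_def)
      have nz: "norm z = k * norm (\<rho> t)" using k by (simp add: z_def norm_mult)
      have "N \<le> Re (Z t) + Im (Z t)" using cmod_le[of "Z t"] pos by (simp add: N_def)
      also have "\<dots> \<le> Im (Z t) / m + Im (Z t)" using im_ge m by (simp add: field_simps)
      finally have "\<mu> * N \<le> Im (Z t)" using m by (simp add: \<mu>_def field_simps)
      then have "k * (\<mu> * N) \<le> k * Im (Z t)" using k by (intro mult_left_mono) auto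
      also have "\<dots> / 2 \<le> Im z" using mult_left_mono[OF im\<rho>, of k] k by (simp add: z_def)
      finally have imz: "Im z \<ge> k * \<mu> * N / 2" by (simp add: mult.assoc)
      have sN: "sqrt N > 0" using N0 by simp
      have "sqrt (k / 2) * sqrt N \<le> sqrt (norm z)"
        unfolding real_sqrt_mult[symmetric] nz
        using mult_left_mono[OF \<rho>_lo, of k] k by (intro real_sqrt_le_mono) simp
      then have "C0 / sqrt (norm z) \<le> C0 / (sqrt (k / 2) * sqrt N)"
        using h(2) k N0 nz \<rho>0 by (intro divide_left_mono mult_pos_pos) auto
      then have Dz: "C0 / sqrt (norm z) \<le> D / sqrt N" by (simp add: D_def)
      have h_le: "norm (hankel_amplitude z) \<le> D / sqrt N"
        using h(6)[OF z] Dz by simp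
      have h'_le: "norm (h' z) \<le> D / sqrt N * (2 / (k * \<mu> * N))"
      proof -
        have "norm (h' z) \<le> C0 / sqrt (norm z) * (1 / Im z)" using h(7)[OF z] by simp
        also have "\<dots> \<le> D / sqrt N * (1 / (k * \<mu> * N / 2))"
          using imz k \<mu> N0 Dz D h(2) z h(3) by (intro mult_mono divide_left_mono mult_pos_pos) auto
        finally show ?thesis by simp
      qed
      define e where "e = exp (\<i> * of_real k * (\<rho> t - Z t))"
      have Re_e: "\<bar>Re (\<i> * of_real k * (\<rho> t - Z t))\<bar> \<le> k"
      proof -
        have "\<bar>Re (\<i> * of_real k * (\<rho> t - Z t))\<bar> = k * \<bar>Im (\<rho> t - Z t)\<bar>"
          using k by (simp add: abs_mult abs_minus_commute flip: right_diff_distrib)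
        also have "\<dots> \<le> k * 1"
          using abs_Im_le_cmod[of "\<rho> t - Z t"] close k by (intro mult_left_mono) auto
        finally show ?thesis by simp
      qed
      have e: "norm e \<le> exp k" "exp (- k) \<le> norm e"
        using Re_e unfolding e_def norm_exp_eq_Re by auto
      have gt: "g t = hankel_amplitude z * e" by (simp add: g z_def e_def)
      have g_le: "norm (g t) \<le> C1 / sqrt N"
        using mult_mono[OF h_le e(1)] D sN by (simp add: gt norm_mult C1_def)
      also have "\<dots> \<le> C1 / sqrt (1 + t)"
        using C1 N_ge t by (intro divide_left_mono mult_pos_pos) auto
      finally have 1: "norm (g t) \<le> C1 / sqrt (1 + t)" .
      have \<rho>'_le: "norm (\<rho>' t) \<le> 2 * a"
      proof -
        have "norm (\<rho>' t) = a * (N / norm (\<rho> t))" by (simp add: \<rho>'_def norm_mult norm_divide a_def N_def)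
        also have "\<dots> \<le> a * 2" using \<rho>_lo \<rho>0 a by (intro mult_left_mono) (auto simp: divide_le_eq)
        finally show ?thesis by simp
      qed
      have \<rho>'_close: "norm (\<rho>' t - Complex 1 S) \<le> a / N"
      proof -
        have "\<rho>' t - Complex 1 S = Complex 1 S * (Z t - \<rho> t) / \<rho> t"
          using \<rho>n0 by (simp add: \<rho>'_def field_simps)
        then have "norm (\<rho>' t - Complex 1 S) = a * norm (\<rho> t - Z t) / norm (\<rho> t)"
          by (simp add: norm_mult norm_divide a_def norm_minus_commute)
        also have "\<dots> \<le> a * (1 / 2) / (N / 2)"
          using close \<rho>_lo N0 a by (intro frac_le mult_left_mono) auto
        finally show ?thesis by simp
      qed
      have "norm (g' t) \<le> (k * (2 * a) * (D / sqrt N * (2 / (k * \<mu> * N))) + D / sqrt N * (k * (a / N))) * exp k"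
      proof -
        have "norm (of_real k * \<rho>' t * h' z) \<le> k * (2 * a) * (D / sqrt N * (2 / (k * \<mu> * N)))"
          unfolding norm_mult using k a \<rho>'_le h'_le by (intro mult_mono) auto
        moreover have "norm (hankel_amplitude z * (\<i> * of_real k * (\<rho>' t - Complex 1 S)))
            \<le> D / sqrt N * (k * (a / N))"
          unfolding norm_mult using k h_le \<rho>'_close D sN by (intro mult_mono) auto
        ultimately have "norm (of_real k * \<rho>' t * h' z
            + hankel_amplitude z * (\<i> * of_real k * (\<rho>' t - Complex 1 S)))
          \<le> k * (2 * a) * (D / sqrt N * (2 / (k * \<mu> * N))) + D / sqrt N * (k * (a / N))"
          by (rule order_trans[OF norm_triangle_ineq add_mono])
        from mult_mono[OF this e(1)] show ?thesis
          using k a D sN \<mu> N0 by (simp add: g'_def z_def e_def norm_mult)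
      qed
      also have "\<dots> = C2 / (sqrt N * N)"
        using k \<mu> N0 by (simp add: C2_def C1_def field_simps)
      also have "sqrt N * N = sqrt N ^ 3" using N0 by (simp add: power3_eq_cube)
      also have "C2 / sqrt N ^ 3 \<le> C2 / sqrt (1 + t) ^ 3"
        using C2 N_ge t by (intro divide_left_mono power_mono mult_pos_pos) auto
      finally have 2: "norm (g' t) \<le> C2 / sqrt (1 + t) ^ 3" .
      have "N \<le> norm Z0 + a * t"
        using norm_triangle_ineq[of Z0 "Complex 1 S * of_real t"] t by (simp add: N_def Z_def norm_mult a_def)
      also have "\<dots> \<le> (norm Z0 + a) * (1 + t)" using t a by (simp add: algebra_simps)
      finally have "k * norm (\<rho> t) \<le> k * (2 * ((norm Z0 + a) * (1 + t)))"
        using \<rho>_hi k by (intro mult_left_mono) auto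
      then have "sqrt (norm z) \<le> sqrt (2 * k * (norm Z0 + a)) * sqrt (1 + t)"
        unfolding real_sqrt_mult[symmetric] nz by (intro real_sqrt_le_mono) (simp add: mult_ac)
      then have "c / (sqrt (2 * k * (norm Z0 + a)) * sqrt (1 + t)) \<le> c / sqrt (norm z)"
        using h(1) nz k \<rho>0 Z0a t mult_pos_pos[OF k Z0a] by (intro divide_left_mono mult_pos_pos) auto
      then have "c / (sqrt (2 * k * (norm Z0 + a)) * sqrt (1 + t)) \<le> norm (hankel_amplitude z)"
        using h(5)[OF z] by simp
      from mult_mono[OF this e(2)] have 3: "norm (g t) \<ge> b / sqrt (1 + t)"
        by (simp add: gt norm_mult b_def)
      have dZ: "(Z has_vector_derivative Complex 1 S) (at t)"
        unfolding Z_def[abs_def] by (auto intro!: derivative_eq_intros)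
      have "((\<lambda>Z. csqrt ((of_real d)\<^sup>2 + Z\<^sup>2)) has_field_derivative 2 * Z t / (2 * \<rho> t)) (at (Z t))"
        using cl(1) unfolding \<rho>_def by (auto intro!: derivative_eq_intros)
      from field_vector_diff_chain_at[OF dZ this]
      have d\<rho>: "(\<rho> has_vector_derivative \<rho>' t) (at t)"
        by (simp add: o_def \<rho>_def[abs_def, symmetric] \<rho>'_def mult.commute)
      have "((\<lambda>t. of_real k * \<rho> t) has_vector_derivative of_real k * \<rho>' t) (at t)"
        by (rule has_vector_derivative_mult_right[OF d\<rho>])
      from field_vector_diff_chain_at[OF this h(4)[OF z, unfolded z_def]]
      have dh: "((\<lambda>t. hankel_amplitude (of_real k * \<rho> t)) has_vector_derivative
          of_real k * \<rho>' t * h' (of_real k * \<rho> t)) (at t)"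
        by (simp add: o_def)
      have "((\<lambda>t. \<i> * of_real k * (\<rho> t - Z t)) has_vector_derivative
          \<i> * of_real k * (\<rho>' t - Complex 1 S)) (at t)"
        by (rule has_vector_derivative_mult_right[OF has_vector_derivative_diff[OF d\<rho> dZ]])
      from field_vector_diff_chain_at[OF this DERIV_exp]
      have de: "((\<lambda>t. exp (\<i> * of_real k * (\<rho> t - Z t))) has_vector_derivative
          \<i> * of_real k * (\<rho>' t - Complex 1 S) * exp (\<i> * of_real k * (\<rho> t - Z t))) (at t)"
        by (simp add: o_def)
      have "(g has_vector_derivative g' t) (at t)"
        unfolding g[abs_def] g'_def
        using has_vector_derivative_mult[OF dh de] by (simp add: algebra_simps)
      with 1 2 3 show ?thesis by blast
    qed
    have "norm (g t) \<le> C / sqrt (1 + t) \<and> norm (g' t) \<le> C / sqrt (1 + t) ^ 3" if "t \<ge> 0" for t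
    proof -
      have "C1 / sqrt (1 + t) \<le> C / sqrt (1 + t)" "C2 / sqrt (1 + t) ^ 3 \<le> C / sqrt (1 + t) ^ 3"
        using that by (auto simp: C_def intro!: divide_right_mono)
      then show ?thesis using main[OF that] by linarith
    qed
    then show "\<exists>g' b. b > 0 \<and> (\<forall>t\<ge>0.
       (pml_amplitude k S d Z0 has_vector_derivative g' t) (at t) \<and>
       norm (pml_amplitude k S d Z0 t) \<le> C / sqrt (1 + t) \<and>
       norm (g' t) \<le> C / sqrt (1 + t) ^ 3 \<and>
       norm (pml_amplitude k S d Z0 t) \<ge> b / sqrt (1 + t))"
      unfolding g_def[symmetric] using main b by blast
  qed
qed

section \<open>The stretched coordinate\<close>

text \<open>
  A closed form without case distinction, from which continuity is immediate.
\<close>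

lemma pml_sigma_eq_clamp:
  assumes "T > 0" "P \<ge> 1"
  shows "pml_sigma H S P T t = S * (min 1 (max 0 ((\<bar>t\<bar> - H) / T))) ^ P"
proof -
  have "0 \<le> (\<bar>t\<bar> - H) / T \<longleftrightarrow> H \<le> \<bar>t\<bar>" "(\<bar>t\<bar> - H) / T \<le> 1 \<longleftrightarrow> \<bar>t\<bar> \<le> H + T"
    using assms by (auto simp: divide_simps)
  then show ?thesis
    using assms by (auto simp: pml_sigma_def min_def max_def)
qed

lemma stretch_inside:
  assumes "\<bar>x2\<bar> \<le> H"
  shows "stretch H S P T x2 = of_real x2"
proof -
  have "(LBINT t=ereal 0..ereal x2. pml_sigma H S P T t) = (LBINT t=ereal 0..ereal x2. 0)"
    using assms by (intro interval_integral_cong) (auto simp: pml_sigma_def einterval_def min_def max_def split: if_splits)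
  then show ?thesis by (simp add: stretch_def)
qed

lemma stretch_beyond:
  assumes "H > 0" "T > 0" "P \<ge> 1" "t > H + T"
  shows "stretch H S P T t = Complex t (S * T / (real P + 1) + S * (t - (H + T)))"
proof -
  have "(pml_sigma H S P T has_integral 0) {0..H}"
    by (rule has_integral_is_0) (simp add: pml_sigma_def)
  moreover have "(pml_sigma H S P T has_integral S * T / (real P + 1)) {H..H + T}"
  proof -
    define F where "F u = S * T / (real P + 1) * ((u - H) / T) ^ (P + 1)" for u
    have "((\<lambda>u. S * ((u - H) / T) ^ P) has_integral F (H + T) - F H) {H..H + T}"
    proof (rule fundamental_theorem_of_calculus)
      fix u :: real
      have "(F has_real_derivative S * T / (real P + 1) * (real (P + 1) * ((u - H) / T) ^ P * (1 / T))) (at u within {H..H + T})"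
        unfolding F_def[abs_def]
        by (rule derivative_eq_intros refl | use assms in simp)+
      also have "S * T / (real P + 1) * (real (P + 1) * ((u - H) / T) ^ P * (1 / T)) = S * ((u - H) / T) ^ P"
      proof -
        define Q where "Q = real P + 1"
        have "Q \<noteq> 0" "real (P + 1) = Q" by (simp_all add: Q_def)
        then show ?thesis using assms unfolding Q_def[symmetric] by simp
      qed
      finally show "(F has_vector_derivative S * ((u - H) / T) ^ P) (at u within {H..H + T})"
        by (simp add: has_real_derivative_iff_has_vector_derivative)
    qed (use assms in auto)
    moreover have "F (H + T) - F H = S * T / (real P + 1)" using assms by (simp add: F_def)
    ultimately show ?thesis
      using assms by (auto simp: pml_sigma_def intro: has_integral_eq[rotated])
  qed
  ultimately have 1: "(pml_sigma H S P T has_integral 0 + S * T / (real P + 1)) {0..H + T}"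
    by (rule has_integral_combine[rotated 2]) (use assms in auto)
  have "((\<lambda>u. S) has_integral S * (t - (H + T))) {H + T..t}"
    using has_integral_const_real[of S "H + T" t] assms by (simp add: mult.commute)
  then have "(pml_sigma H S P T has_integral S * (t - (H + T))) {H + T..t}"
    by (rule has_integral_eq[rotated]) (use assms in \<open>auto simp: pml_sigma_def\<close>)
  with 1 have I: "(pml_sigma H S P T has_integral 0 + S * T / (real P + 1) + S * (t - (H + T))) {0..t}"
    by (rule has_integral_combine[rotated 2]) (use assms in auto)
  have "continuous_on {0..t} (pml_sigma H S P T)"
    unfolding pml_sigma_eq_clamp[OF assms(2,3), abs_def] by (intro continuous_intros) (use assms in auto)
  then have "set_integrable lborel {0..t} (pml_sigma H S P T)"
    by (rule borel_integrable_atLeastAtMost')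
  then have "(LBINT u=ereal 0..ereal t. pml_sigma H S P T u) = integral {0..t} (pml_sigma H S P T)"
    using assms by (intro interval_integral_eq_integral) auto
  also have "\<dots> = S * T / (real P + 1) + S * (t - (H + T))" using I by (simp add: integral_unique)
  finally show ?thesis by (simp add: stretch_def complex_eq_iff)
qed

section \<open>The single-layer integral\<close>

text \<open>
  On the half-line the phases of kernel and density are both affine, up to the bounded correction in
  the amplitude. They combine to a constant factor, which carries the whole decay in \<open>T\<close>, and
  an exponential whose rate is independent of \<open>T\<close>.
\<close>

lemma pml_layer_integrand_eq:
  fixes k1 S s T H :: real and \<beta> :: complex and x :: "real \<times> real"
  assumes H: "H > 0" "T > 0" "P \<ge> 1" and x: "\<bar>snd x\<bar> \<le> H"
    and f: "\<And>t. \<bar>t\<bar> > H + T \<Longrightarrow> f t = - \<Lambda> / 2" and t: "t > H + T"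
  defines "A \<equiv> S * T / (real P + 1)"
  shows "pml_layer_integrand H S P T k1 f (mode_density H S P T s \<beta>) x t
     = \<i> / 4 * exp (\<i> * of_real k1 * Complex (H + T - snd x) A + of_real s * \<i> * \<beta> * Complex (H + T) A)
       * (exp (\<i> * (of_real k1 + of_real s * \<beta>) * Complex 1 S * of_real (t - (H + T)))
          * pml_amplitude k1 S (fst x + \<Lambda> / 2) (Complex (H + T - snd x) A) (t - (H + T)))"
proof -
  define \<tau> where "\<tau> = t - (H + T)"
  define Z0 where "Z0 = Complex (H + T - snd x) A"
  define Z where "Z = Z0 + Complex 1 S * of_real \<tau>"
  define \<rho> where "\<rho> = csqrt ((of_real (fst x + \<Lambda> / 2))\<^sup>2 + Z\<^sup>2)"
  define z where "z = of_real k1 * \<rho>"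
  have st: "stretch H S P T t = Complex (H + T) A + Complex 1 S * of_real \<tau>"
    unfolding stretch_beyond[OF H t] A_def \<tau>_def by (simp add: complex_eq_iff)
  have Zs: "Z = stretch H S P T t - of_real (snd x)"
    unfolding st Z_def Z0_def by (simp add: complex_eq_iff)
  have ft: "f t = - \<Lambda> / 2" using t H by (intro f) simp
  have "(f has_real_derivative 0) (at t)"
    by (rule has_field_derivative_transform_within_open[of "\<lambda>_. - \<Lambda> / 2" _ _ "{H + T<..}"])
       (use t H f in auto)
  then have df: "deriv f t = 0" by (rule DERIV_imp_deriv)
  have "pml_rho H S P T x (f t, t) = \<rho>"
    unfolding pml_rho_def \<rho>_def Zs by (simp add: ft stretch_inside[OF x] power2_commute)
  then have "pml_kernel H S P T k1 x (f t, t) = \<i> / 4 * hankel1_0 z"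
    by (simp add: pml_kernel_def z_def)
  also have "hankel1_0 z = hankel_amplitude z * exp (\<i> * z)"
    by (simp add: hankel_amplitude_def exp_minus field_simps)
  finally have ker: "pml_kernel H S P T k1 x (f t, t) = \<i> / 4 * (hankel_amplitude z * exp (\<i> * z))" .
  have amp: "pml_amplitude k1 S (fst x + \<Lambda> / 2) Z0 \<tau>
      = hankel_amplitude z * exp (\<i> * of_real k1 * (\<rho> - Z))"
    by (simp add: pml_amplitude_def Let_def Z_def \<rho>_def z_def)
  have "\<i> * z + of_real s * \<i> * \<beta> * stretch H S P T t
    = (\<i> * of_real k1 * Z0 + of_real s * \<i> * \<beta> * Complex (H + T) A)
      + (\<i> * (of_real k1 + of_real s * \<beta>) * Complex 1 S * of_real \<tau> + \<i> * of_real k1 * (\<rho> - Z))"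
    unfolding st Z_def z_def by (simp add: algebra_simps)
  then have "exp (\<i> * z) * exp (of_real s * \<i> * \<beta> * stretch H S P T t)
    = exp (\<i> * of_real k1 * Z0 + of_real s * \<i> * \<beta> * Complex (H + T) A)
      * (exp (\<i> * (of_real k1 + of_real s * \<beta>) * Complex 1 S * of_real \<tau>)
         * exp (\<i> * of_real k1 * (\<rho> - Z)))"
    unfolding exp_add[symmetric] by simp
  moreover have "pml_layer_integrand H S P T k1 f (mode_density H S P T s \<beta>) x t
     = \<i> / 4 * hankel_amplitude z * (exp (\<i> * z) * exp (of_real s * \<i> * \<beta> * stretch H S P T t))"
    by (simp add: pml_layer_integrand_def ker mode_density_def df)
  ultimately show ?thesis
    by (simp only: \<tau>_def[symmetric] Z0_def[symmetric] amp mult_ac)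
qed

text \<open>
  Exactly one of the two lemmas on oscillatory integrals applies. Where the integral diverges, its
  conventional value \<open>0\<close> satisfies the bound; for \<open>c = 0\<close> this agrees with \<open>C / 0 = 0\<close>.
\<close>

lemma pml_single_layer_bound:
  fixes k1 \<Lambda> S s H :: real and \<beta> :: complex and x :: "real \<times> real" and f :: "real \<Rightarrow> real \<Rightarrow> real"
  assumes k1: "k1 > 0" and S: "S > 0" and H: "H > 0" and P: "P \<ge> 1" and x: "\<bar>snd x\<bar> \<le> H"
    and f: "\<forall>\<^sub>F T in at_top. \<forall>t. \<bar>t\<bar> > H + T \<longrightarrow> f T t = - \<Lambda> / 2"
  defines "c \<equiv> \<i> * (of_real k1 + of_real s * \<beta>) * Complex 1 S"
  obtains B where
    "\<forall>\<^sub>F T in at_top. norm (pml_single_layer H S P T k1 (f T) (mode_density H S P T s \<beta>) x)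
        \<le> B * exp (Re (\<i> * of_real k1 * Complex (H + T - snd x) (S * T / (real P + 1))
            + of_real s * \<i> * \<beta> * Complex (H + T) (S * T / (real P + 1))))"
    "Re c \<le> 0 \<Longrightarrow> c \<noteq> 0 \<Longrightarrow>
       \<forall>\<^sub>F T in at_top. pml_single_layer_converges H S P T k1 (f T) (mode_density H S P T s \<beta>) x"
proof -
  \<comment> \<open>The initial point \<open>Z0\<close> has slope about \<open>S / (P + 1)\<close> for large \<open>T\<close>; half of it leaves room for the distance \<open>H - x\<^sub>2\<close>.\<close>
  define m where "m = S / (2 * (real P + 1))"
  have m: "0 < m" "m \<le> S"
    using S by (auto simp: m_def divide_le_eq mult_le_cancel_left1)
  define d where "d = fst x + \<Lambda> / 2"
  obtain C R0 where R0: "1 \<le> R0" and amp: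
    "\<And>Z0. Re Z0 \<ge> R0 \<Longrightarrow> Im Z0 \<ge> m * Re Z0 \<Longrightarrow> \<exists>g' b. b > 0 \<and> (\<forall>t\<ge>0.
       (pml_amplitude k1 S d Z0 has_vector_derivative g' t) (at t) \<and>
       norm (pml_amplitude k1 S d Z0 t) \<le> C / sqrt (1 + t) \<and>
       norm (g' t) \<le> C / sqrt (1 + t) ^ 3 \<and>
       norm (pml_amplitude k1 S d Z0 t) \<ge> b / sqrt (1 + t))"
    by (rule pml_amplitude_bounds[OF k1 m]) (rule that)
  define Z0 where "Z0 T = Complex (H + T - snd x) (S * T / (real P + 1))" for T
  define K where "K T = \<i> / 4 * exp (\<i> * of_real k1 * Z0 T
      + of_real s * \<i> * \<beta> * Complex (H + T) (S * T / (real P + 1)))" for T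
  define L where "L T = pml_layer_integrand H S P T k1 (f T) (mode_density H S P T s \<beta>) x" for T
  have main: "norm (integral {H + T<..} (L T)) \<le> norm (K T) * (3 * C / norm c) \<and>
      (Re c \<le> 0 \<and> c \<noteq> 0 \<longrightarrow> L T integrable_on {H + T<..})"
    if T: "T \<ge> R0" "T \<ge> 2 * H" and fT: "\<And>t. \<bar>t\<bar> > H + T \<Longrightarrow> f T t = - \<Lambda> / 2" for T
  proof -
    have T0: "T > 0" using T R0 by simp
    have re: "Re (Z0 T) \<ge> R0" using T x by (simp add: Z0_def)
    have "m * Re (Z0 T) \<le> m * (2 * T)" using T x m by (intro mult_left_mono) (auto simp: Z0_def)
    also have "\<dots> = Im (Z0 T)" by (simp add: m_def Z0_def divide_simps)
    finally have im: "Im (Z0 T) \<ge> m * Re (Z0 T)" .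
    define g where "g = pml_amplitude k1 S d (Z0 T)"
    obtain g' b where g: "b > 0"
        "\<And>t. t \<ge> 0 \<Longrightarrow> (g has_vector_derivative g' t) (at t)"
        "\<And>t. t \<ge> 0 \<Longrightarrow> norm (g t) \<le> C / sqrt (1 + t)"
        "\<And>t. t \<ge> 0 \<Longrightarrow> norm (g' t) \<le> C / sqrt (1 + t) ^ 3"
        "\<And>t. t \<ge> 0 \<Longrightarrow> norm (g t) \<ge> b / sqrt (1 + t)"
      using amp[OF re im] unfolding g_def by blast
    have C: "C \<ge> 0" using order_trans[OF norm_ge_zero g(3)[of 0]] by simp
    define F where "F t = exp (c * of_real t) * g t" for t
    have L: "L T t = K T * F (t - (H + T))" if "t \<in> {H + T<..}" for t
      unfolding L_def K_def F_def g_def c_def Z0_def d_def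
      by (rule pml_layer_integrand_eq[OF H T0 P x fT]) (use that in auto)
    have K: "K T \<noteq> 0" by (simp add: K_def)
    show ?thesis
    proof (cases "Re c \<le> 0 \<and> c \<noteq> 0")
      case True
      have F: "F integrable_on {0<..}" "norm (integral {0<..} F) \<le> 3 * C / norm c"
        unfolding F_def[abs_def]
        using oscillatory_integral_converges[OF g(2,3,4), of c] True by auto
      have "((\<lambda>t. F (t - (H + T))) has_integral integral {0<..} F) {0 + (H + T)<..}"
        using F(1) by (intro has_integral_half_line_shift integrable_integral)
      then have "((\<lambda>t. K T * F (t - (H + T))) has_integral K T * integral {0<..} F) {H + T<..}"
        by (intro has_integral_mult_right) simp
      then have "(L T has_integral K T * integral {0<..} F) {H + T<..}"
        by (rule has_integral_eq[rotated]) (rule L[symmetric])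
      then have "L T integrable_on {H + T<..}" "integral {H + T<..} (L T) = K T * integral {0<..} F"
        by (auto simp: integral_unique)
      then show ?thesis using mult_left_mono[OF F(2), of "norm (K T)"] by (simp add: norm_mult)
    next
      case False
      have "\<not> F integrable_on {0<..}"
        unfolding F_def[abs_def]
        using False oscillatory_integral_diverges[OF g(2,5,1,4), of c] by (auto simp: not_le)
      moreover have "F integrable_on {0<..}" if int: "L T integrable_on {H + T<..}"
      proof -
        obtain I where "(L T has_integral I) {H + T<..}" using int by blast
        from has_integral_half_line_shift[OF this, of "- (H + T)"]
        have "((\<lambda>t. L T (t + (H + T))) has_integral I) {0<..}" by (simp add: algebra_simps)
        then have "((\<lambda>t. inverse (K T) * L T (t + (H + T))) has_integral inverse (K T) * I) {0<..}"
          by (rule has_integral_mult_right)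
        then have "(F has_integral inverse (K T) * I) {0<..}"
          by (rule has_integral_eq[rotated]) (use L K in auto)
        then show ?thesis by blast
      qed
      ultimately have "\<not> L T integrable_on {H + T<..}" by blast
      then have "integral {H + T<..} (L T) = 0" by (rule not_integrable_integral)
      then have "norm (integral {H + T<..} (L T)) \<le> norm (K T) * (3 * C / norm c)"
        using C by simp
      with False show ?thesis by blast
    qed
  qed
  have ev: "\<forall>\<^sub>F T in at_top. T \<ge> R0 \<and> T \<ge> 2 * H \<and> (\<forall>t. \<bar>t\<bar> > H + T \<longrightarrow> f T t = - \<Lambda> / 2)"
    using eventually_ge_at_top[of R0] eventually_ge_at_top[of "2 * H"] f by eventually_elim simp
  show ?thesis
  proof (rule that[of "3 * C / norm c / 4"])
    show "\<forall>\<^sub>F T in at_top. norm (pml_single_layer H S P T k1 (f T) (mode_density H S P T s \<beta>) x)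
        \<le> 3 * C / norm c / 4 * exp (Re (\<i> * of_real k1 * Complex (H + T - snd x) (S * T / (real P + 1))
            + of_real s * \<i> * \<beta> * Complex (H + T) (S * T / (real P + 1))))"
      using ev
    proof eventually_elim
      case (elim T)
      then have "norm (integral {H + T<..} (L T)) \<le> norm (K T) * (3 * C / norm c)"
        using main by blast
      then show ?case
        unfolding pml_single_layer_def L_def K_def Z0_def norm_mult norm_exp_eq_Re by (simp add: mult_ac)
    qed
    assume c: "Re c \<le> 0" "c \<noteq> 0"
    show "\<forall>\<^sub>F T in at_top. pml_single_layer_converges H S P T k1 (f T) (mode_density H S P T s \<beta>) x"
      using ev
    proof eventually_elim
      case (elim T)
      then show ?case using main[of T] c unfolding pml_single_layer_converges_def L_def by blast
    qed
  qed
qed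

lemma frontier_snd_bounds:
  fixes \<Omega> :: "(real \<times> real) set"
  assumes "bounded \<Omega>" "x \<in> frontier \<Omega>"
  shows "snd x \<le> Sup (snd ` \<Omega>)" "Inf (snd ` \<Omega>) \<le> snd x"
proof -
  have b: "bounded (snd ` \<Omega>)" using assms(1) by (rule bounded_snd)
  have "x \<in> closure \<Omega>" using assms(2) by (simp add: frontier_def)
  moreover have "closure \<Omega> \<subseteq> {p. snd p \<le> Sup (snd ` \<Omega>)}" "closure \<Omega> \<subseteq> {p. Inf (snd ` \<Omega>) \<le> snd p}"
    using bounded_imp_bdd_above[OF b] bounded_imp_bdd_below[OF b]
    by (intro closure_minimal closed_Collect_le continuous_intros; auto intro: cSup_upper cInf_lower)+
  ultimately show "snd x \<le> Sup (snd ` \<Omega>)" "Inf (snd ` \<Omega>) \<le> snd x" by auto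
qed

theorem theorem3p2:
  fixes k1 \<Lambda> \<theta> H S s :: real and P :: nat and n :: int
    and \<Omega> :: "(real \<times> real) set" and f :: "real \<Rightarrow> real \<Rightarrow> real" and x :: "real \<times> real"
  assumes "k1 > 0" and "\<Lambda> > 0" and "- pi / 2 < \<theta>" and "\<theta> < pi / 2"
    and "bounded \<Omega>" and "C2_domain \<Omega>"
    and "H > 0" and "H > max (Sup (snd ` \<Omega>)) (- Inf (snd ` \<Omega>))"
    and "S > 0" and "P \<ge> 2"
    and "\<forall>\<^sub>F T in at_top. smooth (f T) \<and> closure \<Omega> \<subseteq> unit_cell (f T) \<Lambda>
           \<and> (\<forall>t. \<bar>t\<bar> > H + T \<longrightarrow> f T t = - \<Lambda> / 2)"
    and "x \<in> frontier \<Omega>"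
    and "s \<in> {1, - 1}"
  defines "\<beta> \<equiv> beta k1 \<Lambda> \<theta> n"
  shows
    "(n \<in> propagating k1 \<Lambda> \<theta> \<longrightarrow>
        (\<lambda>T. pml_single_layer H S P T k1 (f T) (mode_density H S P T s \<beta>) x)
          \<in> O[at_top](\<lambda>T. exp (- (of_real k1 + of_real s * \<beta>) * of_real (S * T / (real P + 1)))))
     \<and> (n \<in> evanescent k1 \<Lambda> \<theta> \<longrightarrow>
        (\<lambda>T. pml_single_layer H S P T k1 (f T) (mode_density H S P T s \<beta>) x)
          \<in> O[at_top](\<lambda>T. of_real (exp (- k1 * (S * T / (real P + 1)) - s * norm \<beta> * (H + T)))))
     \<and> ((n \<in> propagating k1 \<Lambda> \<theta> \<and> (s = 1 \<or> alpha k1 \<Lambda> \<theta> n \<noteq> 0)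
          \<or> n \<in> evanescent k1 \<Lambda> \<theta> \<and> (s = 1 \<or> norm \<beta> \<le> k1 * S)) \<longrightarrow>
        (\<forall>\<^sub>F T in at_top.
           pml_single_layer_converges H S P T k1 (f T) (mode_density H S P T s \<beta>) x))"
proof -
  have x: "\<bar>snd x\<bar> \<le> H"
    using frontier_snd_bounds[OF assms(5) assms(12)] assms(8)
    unfolding max_less_iff_conj abs_le_iff by linarith
  have f: "\<forall>\<^sub>F T in at_top. \<forall>t. \<bar>t\<bar> > H + T \<longrightarrow> f T t = - \<Lambda> / 2"
    using assms(11) by eventually_elim blast
  define c where "c = \<i> * (of_real k1 + of_real s * \<beta>) * Complex 1 S"
  define \<alpha> where "\<alpha> = alpha k1 \<Lambda> \<theta> n"
  obtain B where B:
    "\<forall>\<^sub>F T in at_top. norm (pml_single_layer H S P T k1 (f T) (mode_density H S P T s \<beta>) x)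
        \<le> B * exp (Re (\<i> * of_real k1 * Complex (H + T - snd x) (S * T / (real P + 1))
            + of_real s * \<i> * \<beta> * Complex (H + T) (S * T / (real P + 1))))"
    and conv: "Re c \<le> 0 \<Longrightarrow> c \<noteq> 0 \<Longrightarrow>
       \<forall>\<^sub>F T in at_top. pml_single_layer_converges H S P T k1 (f T) (mode_density H S P T s \<beta>) x"
    unfolding c_def
    by (rule pml_single_layer_bound[OF assms(1,9,7) _ x f, of P s \<beta>]) (use assms(10) in auto)
  have s: "s = 1 \<or> s = - 1" using assms(13) by simp
  have propag: "\<beta> = of_real (sqrt (k1\<^sup>2 - \<alpha>\<^sup>2))" "\<alpha>\<^sup>2 < k1\<^sup>2" if "n \<in> propagating k1 \<Lambda> \<theta>"
  proof -
    have "\<bar>\<alpha>\<bar> < k1" using that by (simp add: propagating_def \<alpha>_def)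
    then show "\<beta> = of_real (sqrt (k1\<^sup>2 - \<alpha>\<^sup>2))" "\<alpha>\<^sup>2 < k1\<^sup>2"
      using assms(1) power_strict_mono[of "\<bar>\<alpha>\<bar>" k1 2] by (auto simp: \<beta>_def beta_def \<alpha>_def)
  qed
  have evan: "\<beta> = \<i> * of_real (norm \<beta>)" "norm \<beta> > 0" if "n \<in> evanescent k1 \<Lambda> \<theta>"
  proof -
    have gt: "\<bar>\<alpha>\<bar> > k1" using that by (simp add: evanescent_def \<alpha>_def)
    have "k1\<^sup>2 < \<alpha>\<^sup>2" using gt assms(1) power_strict_mono[of k1 "\<bar>\<alpha>\<bar>" 2] by simp
    then have "sqrt (\<alpha>\<^sup>2 - k1\<^sup>2) > 0" by simp
    moreover have "\<beta> = \<i> * of_real (sqrt (\<alpha>\<^sup>2 - k1\<^sup>2))"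
      using gt by (simp add: \<beta>_def beta_def \<alpha>_def)
    ultimately show "\<beta> = \<i> * of_real (norm \<beta>)" "norm \<beta> > 0" by (simp_all add: norm_mult)
  qed
  show ?thesis
  proof (intro conjI impI)
    assume n: "n \<in> propagating k1 \<Lambda> \<theta>"
    show "(\<lambda>T. pml_single_layer H S P T k1 (f T) (mode_density H S P T s \<beta>) x)
          \<in> O[at_top](\<lambda>T. exp (- (of_real k1 + of_real s * \<beta>) * of_real (S * T / (real P + 1))))"
      using B by (intro bigoI[of _ B]) (simp add: norm_exp_eq_Re propag(1)[OF n] algebra_simps)
  next
    assume n: "n \<in> evanescent k1 \<Lambda> \<theta>"
    have "Re (of_real s * \<i> * \<beta> * Complex a b) = - s * norm \<beta> * a" for a b
      by (subst evan(1)[OF n]) simp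
    then have "Re (\<i> * of_real k1 * Complex (H + T - snd x) a + of_real s * \<i> * \<beta> * Complex (H + T) a)
        = - k1 * a - s * norm \<beta> * (H + T)" for T a
      unfolding plus_complex.sel by simp
    note B' = B[unfolded this]
    show "(\<lambda>T. pml_single_layer H S P T k1 (f T) (mode_density H S P T s \<beta>) x)
          \<in> O[at_top](\<lambda>T. of_real (exp (- k1 * (S * T / (real P + 1)) - s * norm \<beta> * (H + T))))"
      using B' by (intro bigoI[of _ B]) simp
  next
    assume "n \<in> propagating k1 \<Lambda> \<theta> \<and> (s = 1 \<or> alpha k1 \<Lambda> \<theta> n \<noteq> 0)
          \<or> n \<in> evanescent k1 \<Lambda> \<theta> \<and> (s = 1 \<or> norm \<beta> \<le> k1 * S)"
    then have "Re c \<le> 0 \<and> c \<noteq> 0"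
    proof (elim disjE conjE)
      assume n: "n \<in> propagating k1 \<Lambda> \<theta>"
      define b where "b = sqrt (k1\<^sup>2 - \<alpha>\<^sup>2)"
      have b: "b > 0" using propag(2)[OF n] by (simp add: b_def)
      have cb: "c = Complex (- S * (k1 + s * b)) (k1 + s * b)"
        unfolding c_def propag(1)[OF n] b_def[symmetric] by (simp add: complex_eq_iff)
      have "Re c \<le> 0 \<and> c \<noteq> 0" if "k1 + s * b > 0"
        using that assms(9) by (auto simp: cb complex_eq_iff)
      then show "Re c \<le> 0 \<and> c \<noteq> 0" if "s = 1" using that b assms(1) by simp
      assume "alpha k1 \<Lambda> \<theta> n \<noteq> 0"
      then have "b < sqrt (k1\<^sup>2)" unfolding b_def by (subst real_sqrt_less_iff) (simp add: \<alpha>_def)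
      then have "k1 + s * b > 0" using s b assms(1) by auto
      then show "Re c \<le> 0 \<and> c \<noteq> 0" by fact
    next
      assume n: "n \<in> evanescent k1 \<Lambda> \<theta>"
      have cb: "c = Complex (- s * norm \<beta> - k1 * S) (k1 - s * norm \<beta> * S)"
        unfolding c_def by (subst evan(1)[OF n]) (simp add: complex_eq_iff algebra_simps)
      have kS: "k1 * S > 0" using assms(1,9) by simp
      have minus: "Re c \<le> 0 \<and> c \<noteq> 0" if "s = 1"
      proof -
        have "Re c = - norm \<beta> - k1 * S" by (simp add: cb that)
        then have "Re c < 0" using evan(2)[OF n] kS by linarith
        then show ?thesis by auto
      qed
      then show "Re c \<le> 0 \<and> c \<noteq> 0" if "s = 1" using that .
      assume le: "norm \<beta> \<le> k1 * S"
      show "Re c \<le> 0 \<and> c \<noteq> 0"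
      proof (cases "s = 1")
        case False
        then have "s = - 1" using s by simp
        then have "Re c = norm \<beta> - k1 * S" "Im c = k1 + norm \<beta> * S" by (simp_all add: cb)
        moreover have "k1 + norm \<beta> * S > 0" using assms(1,9) by (simp add: add_pos_nonneg)
        ultimately show ?thesis using le by auto
      qed (rule minus)
    qed
    then show "\<forall>\<^sub>F T in at_top.
           pml_single_layer_converges H S P T k1 (f T) (mode_density H S P T s \<beta>) x"
      using conv by blast
  qed
qed

end
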